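(* Let $N\ge 1$. Set $$G(x,y,t):=\Gamma_N(x-y,t)-\Gamma_N(x-y^*,t)+H(x,y,t)$$ for $(x,y,t)\in D:=\overline{\Omega}\times\overline{\Omega}\times(0,\infty)$, where $y^*=(y',-y_N)$ for $y=(y',y_N)\in\overline{\Omega}$ and $$H(x,y,t):=-2\int_0^t (\partial_{x_N}\Gamma_N)(x-y^*+\tau e_N,t-\tau)\,d\tau .$$ Then the following hold. (1) $G$ is the fundamental solution to the heat equation in $\Omega$ with the homogeneous dynamical boundary condition, that is: (a) for any fixed $y\in\overline\Omega$, the function $G=G(x,y,t)$ satisfies, as a function of the variables $(x,t)\in\overline{\Omega}\times(0,\infty)$, $$\partial_t G-\Delta_x G=0\ \text{ in }\ \Omega\times(0,\infty),\qquad \partial_tG+\partial_\nu G=0\ \text{ on }\ \partial\Omega\times(0,\infty);$$ (b) for any $\zeta\in C_0(\Omega)$, $$\lim_{t\to +0}\int_\Omega G(x,y,t)\zeta(x)\,dx=\zeta(y),\qquad y\in\Omega;$$ (c) for any $\eta\in C_0(\partial\Omega)$, $$\lim_{t\to +0}\int_{\partial\Omega} G(x,y,t)\eta(x)\,d\sigma(x)=\eta(y),\qquad y\in\partial\Omega.$$ (2) $G(x,y,t)=G(y,x,t)$ for all $(x,y,t)\in D$. (3) For any $(y,t)\in\overline\Omega\times(0,\infty)$, $$\int_\Omega G(x,y,t)\,dx+\int_{\partial\Omega} G(x,y,t)\,d\sigma(x)=1.$$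
   Context: $N\ge1$ is an integer and $\Omega:=\{x=(x',x_N)\in\mathbb R^N: x'\in\mathbb R^{N-1},\ x_N\in(0,\infty)\}$; if $N=1$, then $\Omega=(0,\infty)$ and $\partial\Omega=\{0\}$; if $N\ge2$, $\partial\Omega=\mathbb R^{N-1}\times\{0\}$ is identified with $\mathbb R^{N-1}$. $\partial_\nu:=-\partial/\partial x_N$ is the outer normal derivative (acting on the $x$ variable). $\sigma$ is the surface measure on $\partial\Omega$ if $N\ge2$, and $\sigma(\{0\})=1$ if $N=1$. $e_N=(0,\dots,0,1)\in\mathbb R^N$. $\Gamma_N(x,t):=(4\pi t)^{-N/2}e^{-|x|^2/(4t)}$ for $(x,t)\in\mathbb R^N\times(0,\infty)$ is the Gauss kernel. $C_0(\Omega)$ denotes the continuous compactly supported functions on $\Omega$; $C_0(\partial\Omega)=C_0(\mathbb R^{N-1})$ (continuous compactly supported functions) if $N\ge2$, and $C_0(\partial\Omega)=\mathbb R$ if $N=1$. *)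

theory Defs
  imports "HOL-Analysis.Analysis"
begin

text \<open>
  \<open>\<real>\<^sup>N\<close> is \<open>real ^ 'n\<close> with \<open>N = CARD('n)\<close>, so that \<open>N \<ge> 1\<close> is arbitrary. A finite index type has no
  canonical last element; the index \<open>k :: 'n\<close> names the distinguished coordinate \<open>x\<^sub>N\<close>.
\<close>

definition half_space :: "'n::finite \<Rightarrow> (real ^ 'n) set" where
  "half_space k = {x. 0 < x $ k}"

lemma closure_half_space: "closure (half_space k) = {x. 0 \<le> x $ k}"
  using closure_halfspace_component_gt[of 0 k] by (simp add: half_space_def)

lemma open_half_space: "open (half_space k)"
  using open_halfspace_component_gt_cart[of 0 k] by (simp add: half_space_def)

lemma frontier_half_space: "frontier (half_space k) = {x. x $ k = 0}"
  using interior_open[OF open_half_space[of k]] closure_half_space[of k]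
  by (auto simp: frontier_def half_space_def)

text \<open>
  Surface measure on \<open>\<real>\<^sup>N\<^sup>-\<^sup>1 \<times> {0}\<close>: the image of Lebesgue measure in the remaining \<open>N - 1\<close>
  coordinates. For \<open>N = 1\<close> the product is over the empty index set, i.e. a one-point probability
  space, and the result is the unit mass at \<open>0\<close> (see below).
\<close>

definition surface_measure :: "'n::finite \<Rightarrow> (real ^ 'n) measure" where
  "surface_measure k =
     distr (PiM (UNIV - {k}) (\<lambda>_. lborel)) borel (\<lambda>f. \<chi> i. if i = k then 0 else f i)"

lemma measurable_boundary_embedding:
  fixes k :: "'n::finite"
  shows "(\<lambda>f. \<chi> i. if i = k then 0 else f i)
     \<in> measurable (PiM (UNIV - {k}) (\<lambda>_. lborel :: real measure)) (borel :: (real ^ 'n) measure)"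
proof (subst borel_measurable_euclidean_space, rule ballI)
  fix b :: "real ^ 'n"
  assume "b \<in> Basis"
  then obtain i where b: "b = axis i 1"
    by (auto simp: Basis_vec_def)
  show "(\<lambda>f. (\<chi> j. if j = k then 0 else f j) \<bullet> b)
     \<in> borel_measurable (PiM (UNIV - {k}) (\<lambda>_. lborel :: real measure))"
  proof (cases "i = k")
    case True
    then show ?thesis by (simp add: b inner_axis)
  next
    case False
    then have "(\<lambda>f. f i) \<in> measurable (PiM (UNIV - {k}) (\<lambda>_. lborel :: real measure)) lborel"
      by (intro measurable_component_singleton) auto
    with False show ?thesis by (simp add: b inner_axis)
  qed
qed

lemma surface_measure_dim1:
  fixes k :: "'n::finite"
  assumes "CARD('n) = 1"
  shows "frontier (half_space k) = {0}"
    and "A \<in> sets borel \<Longrightarrow> emeasure (surface_measure k) A = indicator A 0"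
proof -
  have U: "(UNIV :: 'n set) = {k}"
    using assms by (metis UNIV_I card_1_singletonE singletonD)
  then have eq: "i = k" for i :: 'n by blast
  show "frontier (half_space k) = {0}"
    unfolding frontier_half_space by (auto simp: vec_eq_iff) (metis eq)
  have z: "(\<lambda>f. \<chi> i. if i = k then 0 else f i) = (\<lambda>_::'n \<Rightarrow> real. (0 :: real ^ 'n))"
    by (auto simp: fun_eq_iff vec_eq_iff) (metis eq)
  have E: "UNIV - {k} = {}" using U by blast
  show "emeasure (surface_measure k) A = indicator A 0" if "A \<in> sets borel"
    unfolding surface_measure_def z E using that
    by (cases "0 \<in> A") (simp_all add: emeasure_distr space_PiM_empty)
qed

definition reflect :: "'n::finite \<Rightarrow> real ^ 'n \<Rightarrow> real ^ 'n" where
  "reflect k y = (\<chi> i. if i = k then - (y $ k) else y $ i)"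

definition partial_deriv :: "'n::finite \<Rightarrow> (real ^ 'n \<Rightarrow> real) \<Rightarrow> real ^ 'n \<Rightarrow> real" where
  "partial_deriv i u x = deriv (\<lambda>s. u (x + s *\<^sub>R axis i 1)) 0"

definition has_partial_deriv :: "'n::finite \<Rightarrow> (real ^ 'n \<Rightarrow> real) \<Rightarrow> real \<Rightarrow> real ^ 'n \<Rightarrow> bool" where
  "has_partial_deriv i u d x \<longleftrightarrow> ((\<lambda>s. u (x + s *\<^sub>R axis i 1)) has_real_derivative d) (at 0)"

text \<open>
  Relational form, so that the existence of the derivatives is part of the assertion: \<open>v i\<close> is
  \<open>\<partial>\<^sub>i u\<close> near \<open>x\<close> and \<open>w i\<close> is \<open>\<partial>\<^sub>i \<partial>\<^sub>i u\<close> at \<open>x\<close>.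
\<close>

definition has_laplacian :: "(real ^ 'n::finite \<Rightarrow> real) \<Rightarrow> real \<Rightarrow> real ^ 'n \<Rightarrow> bool" where
  "has_laplacian u L x \<longleftrightarrow>
     (\<exists>v w. (\<forall>i. \<forall>\<^sub>F z in nhds x. has_partial_deriv i u (v i z) z) \<and>
            (\<forall>i. has_partial_deriv i (v i) (w i) x) \<and>
            L = (\<Sum>i\<in>UNIV. w i))"

text \<open>
  \<open>\<partial>\<^sub>\<nu> = - \<partial>/\<partial>x\<^sub>N\<close> at a boundary point; the derivative is one-sided because the function lives on the
  closed half-space.
\<close>

definition has_normal_deriv :: "'n::finite \<Rightarrow> (real ^ 'n \<Rightarrow> real) \<Rightarrow> real \<Rightarrow> real ^ 'n \<Rightarrow> bool" where
  "has_normal_deriv k u d x \<longleftrightarrow>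
     ((\<lambda>s. u (x + s *\<^sub>R axis k 1)) has_real_derivative (- d)) (at 0 within {0..})"

definition gauss_kernel :: "real ^ 'n::finite \<Rightarrow> real \<Rightarrow> real" where
  "gauss_kernel x t =
     (4 * pi * t) powr (- (real CARD('n) / 2)) * exp (- ((norm x)\<^sup>2 / (4 * t)))"

definition H_integrand :: "'n::finite \<Rightarrow> real ^ 'n \<Rightarrow> real ^ 'n \<Rightarrow> real \<Rightarrow> real \<Rightarrow> real" where
  "H_integrand k x y t \<tau> =
     partial_deriv k (\<lambda>z. gauss_kernel z (t - \<tau>)) (x - reflect k y + \<tau> *\<^sub>R axis k 1)"

definition H_kernel :: "'n::finite \<Rightarrow> real ^ 'n \<Rightarrow> real ^ 'n \<Rightarrow> real \<Rightarrow> real" where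
  "H_kernel k x y t = - 2 * (LINT \<tau>:{0<..<t}|lborel. H_integrand k x y t \<tau>)"

definition G_kernel :: "'n::finite \<Rightarrow> real ^ 'n \<Rightarrow> real ^ 'n \<Rightarrow> real \<Rightarrow> real" where
  "G_kernel k x y t =
     gauss_kernel (x - y) t - gauss_kernel (x - reflect k y) t + H_kernel k x y t"

text \<open>
  Continuous functions on \<open>S\<close> with compact support, the support being the closure relative to \<open>S\<close>.
  Values outside \<open>S\<close> are irrelevant. If \<open>S\<close> is a single point, every function qualifies.
\<close>

definition compactly_supported_on :: "('a::euclidean_space) set \<Rightarrow> ('a \<Rightarrow> real) \<Rightarrow> bool" where
  "compactly_supported_on S f \<longleftrightarrow>
     continuous_on S f \<and> compact (S \<inter> closure {x \<in> S. f x \<noteq> 0})"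

end

theory Submission
  imports Defs "HOL-Probability.Distributions"
begin

text \<open>
  With \<open>z = x - y\<^sup>*\<close> and \<open>\<tau> = t \<rho>\<close>, the kernel \<open>H\<close> becomes an integral over the fixed interval \<open>[0, 1]\<close> whose
  integrand, extended by \<open>0\<close> at \<open>\<rho> = 1\<close>, is continuous together with its derivatives, because
  \<open>z + \<tau> e\<^sub>N\<close> stays away from the origin there. So one may differentiate under the integral sign, and
  integrating \<open>\<partial>\<^sub>\<rho>\<close> of the integrand over \<open>[0, 1]\<close> yields both the heat equation and
  \<open>\<partial>\<^sub>t H - \<partial>\<^sub>N H = - 2 \<partial>\<^sub>N \<Gamma>(z, t)\<close>, which on the boundary cancels the normal derivative of the Dirichlet part.
  Symmetry holds since \<open>x - y\<^sup>*\<close> and \<open>y - x\<^sup>*\<close> have the same norm and the same \<open>N\<close>-th component.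

  For the total mass, Tonelli and integration in the tangential variables leave one-dimensional integrals;
  the interior and boundary masses of \<open>H\<close> add up to the integral of
  \<open>d/d\<tau> erf ((y\<^sub>N + \<tau>) / (2 \<surd>(t - \<tau>)))\<close> over \<open>(0, t)\<close>, that is \<open>1 - erf (y\<^sub>N / (2 \<surd>t))\<close>, and the Dirichlet part contributes
  \<open>erf (y\<^sub>N / (2 \<surd>t))\<close>. Since the interior mass of \<open>H\<close> is \<open>O(\<surd>t)\<close>, the initial conditions follow from the masses
  and second moments of the nonnegative kernels.
\<close>

section \<open>The Gauss profile\<close>

text \<open>Where \<open>H\<close> comes from: the Dirichlet part \<open>D\<close> of
  \<open>G\<close> vanishes on the boundary, so there the dynamical condition becomes the transport
  equation \<open>\<partial>\<^sub>t H - \<partial>\<^sub>N H = \<partial>\<^sub>N D\<close>, whose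
  right-hand side equals \<open>- 2 \<partial>\<^sub>N \<Gamma>(z, t)\<close>. Its characteristics
  are the lines on which \<open>x\<^sub>N + t\<close> is constant, and \<open>H\<close> collects
  this source along them. Since the source solves the heat equation and vanishes at time 0 off the
  origin, \<open>H\<close> inherits the heat equation. The delicate place is the end
  \<open>\<rho> = 1\<close>, where the time argument is 0. The derivative along the ray is therefore
  integrated with two weights: weight 1 leaves the value at \<open>\<rho> = 0\<close>, which is the
  source in the boundary condition; weight \<open>\<rho>\<close> leaves no end value and yields the
  time derivative. Masses are computed as nonnegative extended integrals, so that Tonelli applies at
  once and the integrability claims follow from the finite values.\<close>

text \<open>
  \<open>heat_phi m (|z|\<^sup>2) s\<close> with \<open>m = N/2\<close> is the Gauss kernel up to a constant; differentiation only raises \<open>m\<close>.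
  The value \<open>0\<close> for \<open>s \<le> 0\<close> is the continuous extension as long as \<open>r > 0\<close>.
\<close>

definition heat_phi :: "real \<Rightarrow> real \<Rightarrow> real \<Rightarrow> real" where
  "heat_phi m r s = (if s > 0 then s powr (-m) * exp (- (r / (4 * s))) else 0)"

lemma heat_phi_nonneg [simp]: "0 \<le> heat_phi m r s"
  by (simp add: heat_phi_def)

lemma heat_phi_at_0 [simp]: "heat_phi m r 0 = 0"
  by (simp add: heat_phi_def)

lemma heat_phi_mono: "r \<le> r' \<Longrightarrow> heat_phi m r' s \<le> heat_phi m r s"
  by (auto simp: heat_phi_def intro!: mult_left_mono divide_right_mono)

lemma heat_phi_tendsto_0:
  assumes "r > 0"
  shows "(heat_phi m r \<longlongrightarrow> 0) (at 0)"
proof (rule filterlim_split_at)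
  show "(heat_phi m r \<longlongrightarrow> 0) (at_left 0)"
    by (rule tendsto_eventually) (auto simp: eventually_at_filter heat_phi_def)
  have "((\<lambda>s. s powr (-m) * exp (- (r / (4 * s)))) \<longlongrightarrow> 0) (at_right 0)"
    using assms by real_asymp
  then show "(heat_phi m r \<longlongrightarrow> 0) (at_right 0)"
    by (rule Lim_transform_eventually) (auto simp: eventually_at_filter heat_phi_def)
qed

lemma isCont_heat_phi:
  assumes "r > 0 \<or> s > 0"
  shows "isCont (\<lambda>p. heat_phi m (fst p) (snd p)) (r, s)"
proof -
  consider "s > 0" | "s < 0" | "s = 0" "r > 0" using assms by linarith
  then show ?thesis
  proof cases
    case 1
    have "\<forall>\<^sub>F p in nhds (r, s). p \<in> UNIV \<times> {0<..}"
      using 1 by (intro eventually_nhds_in_open open_Times) auto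
    then have ev: "\<forall>\<^sub>F p in nhds (r, s). heat_phi m (fst p) (snd p)
        = snd p powr (-m) * exp (- (fst p / (4 * snd p)))"
      by eventually_elim (auto simp: heat_phi_def)
    show ?thesis
      unfolding isCont_cong[OF ev] using 1 by (auto intro!: continuous_intros)
  next
    case 2
    have "\<forall>\<^sub>F p in nhds (r, s). p \<in> UNIV \<times> {..<0}"
      using 2 by (intro eventually_nhds_in_open open_Times) auto
    then have ev: "\<forall>\<^sub>F p in nhds (r, s). heat_phi m (fst p) (snd p) = 0"
      by eventually_elim (auto simp: heat_phi_def)
    show ?thesis
      unfolding isCont_cong[OF ev] by simp
  next
    case 3
    \<comment> \<open>Near \<open>(r, 0)\<close> the first coordinate exceeds \<open>r / 2\<close>.
      As \<open>heat_phi\<close> decreases in its first variable, the one-variable function frozen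
      at \<open>r / 2\<close> is a majorant, and it tends to 0.\<close>
    have "isCont (heat_phi m (r / 2)) 0"
      using heat_phi_tendsto_0[of "r / 2" m] 3 by (simp add: isCont_def)
    moreover have "(snd \<longlongrightarrow> 0) (at (r, 0::real))"
      using tendsto_snd[OF tendsto_ident_at, of "(r, 0::real)" UNIV] by simp
    ultimately have "((\<lambda>p. heat_phi m (r / 2) (snd p)) \<longlongrightarrow> 0) (at (r, 0))"
      using isCont_tendsto_compose by fastforce
    moreover have "\<forall>\<^sub>F p in nhds (r, 0::real). p \<in> {r / 2<..} \<times> UNIV"
      using 3 by (intro eventually_nhds_in_open open_Times) auto
    then have "\<forall>\<^sub>F p in at (r, 0::real). fst p > r / 2"
      by (auto simp: eventually_at_filter elim: eventually_mono)
    then have "\<forall>\<^sub>F p in at (r, 0). norm (heat_phi m (fst p) (snd p)) \<le> heat_phi m (r / 2) (snd p)"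
      by eventually_elim (auto intro: heat_phi_mono)
    ultimately show ?thesis
      using 3 by (auto simp: isCont_def intro: Lim_null_comparison)
  qed
qed

lemma continuous_on_heat_phi [continuous_intros]:
  assumes "continuous_on S f" "continuous_on S g" "\<And>x. x \<in> S \<Longrightarrow> f x > 0 \<or> g x > 0"
  shows "continuous_on S (\<lambda>x. heat_phi m (f x) (g x))"
proof -
  have "continuous_on ((\<lambda>x. (f x, g x)) ` S) (\<lambda>p. heat_phi m (fst p) (snd p))"
    using assms(3) by (auto intro!: continuous_at_imp_continuous_on isCont_heat_phi)
  from continuous_on_compose[OF continuous_on_Pair[OF assms(1,2)] this]
  show ?thesis by (simp add: o_def)
qed

lemma measurable_heat_phi [measurable (raw)]:
  assumes [measurable]: "f \<in> borel_measurable M" "g \<in> borel_measurable M"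
  shows "(\<lambda>x. heat_phi m (f x) (g x)) \<in> borel_measurable M"
  unfolding heat_phi_def by measurable

lemma heat_phi_divide: "s > 0 \<Longrightarrow> heat_phi m r s / s = heat_phi (m + 1) r s"
  by (simp add: heat_phi_def powr_diff powr_minus field_simps powr_add)

text \<open>For \<open>s \<le> 0\<close> the function and the claimed derivative both vanish
  identically, so the formula also covers the endpoint \<open>\<rho> = 1\<close> of a ray, where the
  Leibniz rule requires it.\<close>

lemma DERIV_heat_phi_space:
  assumes "(R has_real_derivative R') (at u within X)"
  shows "((\<lambda>u. heat_phi m (R u) s) has_real_derivative (- (R' / 4) * heat_phi (m + 1) (R u) s))
           (at u within X)"
proof (cases "s > 0")
  case True
  show ?thesis
    using True unfolding heat_phi_def
    by (auto intro!: derivative_eq_intros assms simp: powr_diff powr_minus field_simps powr_add)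
qed (simp add: heat_phi_def)

lemma DERIV_heat_phi:
  assumes R: "(R has_real_derivative R') (at u within X)"
    and \<sigma>: "(\<sigma> has_real_derivative \<sigma>') (at u within X)"
    and pos: "\<sigma> u > 0" and "u \<in> X"
  shows "((\<lambda>u. heat_phi m (R u) (\<sigma> u)) has_real_derivative
           (- (R' / 4) * heat_phi (m + 1) (R u) (\<sigma> u)
            + \<sigma>' * (- m * heat_phi (m + 1) (R u) (\<sigma> u) + R u / 4 * heat_phi (m + 2) (R u) (\<sigma> u))))
           (at u within X)"
proof -
  let ?f = "\<lambda>u. \<sigma> u powr (-m) * exp (- (R u / (4 * \<sigma> u)))"
  have d: "(?f has_real_derivative
           (- (R' / 4) * heat_phi (m + 1) (R u) (\<sigma> u)
            + \<sigma>' * (- m * heat_phi (m + 1) (R u) (\<sigma> u) + R u / 4 * heat_phi (m + 2) (R u) (\<sigma> u))))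
           (at u within X)"
    using pos unfolding heat_phi_def
    by (auto intro!: derivative_eq_intros R \<sigma> simp: powr_diff powr_minus field_simps powr_add power2_eq_square)
  have "(\<sigma> \<longlongrightarrow> \<sigma> u) (at u within X)"
    using DERIV_continuous[OF \<sigma>] by (simp add: continuous_within)
  then have "\<forall>\<^sub>F v in at u within X. \<sigma> v > 0"
    using pos by (rule order_tendstoD)
  then have "\<forall>\<^sub>F v in at u within X. heat_phi m (R v) (\<sigma> v) = ?f v"
    by eventually_elim (simp add: heat_phi_def)
  then show ?thesis
    using d pos \<open>u \<in> X\<close>
    by (subst has_field_derivative_cong_eventually[where g = ?f]) (auto simp: heat_phi_def)
qed

lemma norm_add_axis:
  "(norm (z + u *\<^sub>R axis i 1))\<^sup>2 = (norm z)\<^sup>2 + 2 * u * z $ i + u\<^sup>2" for z :: "real ^ 'n::finite"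
  unfolding power2_norm_eq_inner
  by (simp add: inner_axis inner_axis' power2_eq_square algebra_simps)

section \<open>Integrals along the ray \<open>z + \<tau> e\<^sub>N\<close>\<close>

text \<open>Up to a constant, \<open>H(x, y, t) = t * ray_integral k 1 (N/2 + 1) (x - y\<^sup>*) t\<close>; here \<open>\<rho> = \<tau>/t\<close>.\<close>

definition ray_integral :: "'n::finite \<Rightarrow> nat \<Rightarrow> real \<Rightarrow> real ^ 'n \<Rightarrow> real \<Rightarrow> real" where
  "ray_integral k j m z t = integral {0..1} (\<lambda>\<rho>. (z $ k + t * \<rho>) ^ j *
     heat_phi m ((norm (z + (t * \<rho>) *\<^sub>R axis k 1))\<^sup>2) (t * (1 - \<rho>)))"

text \<open>The two degenerations of \<open>heat_phi\<close> never meet: the time argument vanishes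
  only at \<open>\<rho> = 1\<close>, and there the \<open>k\<close>-th component of the ray point is
  \<open>z $ k + t > 0\<close>. This holds even for \<open>z = 0\<close>, that is, for coinciding
  boundary points.\<close>

lemma ray_point_pos:
  fixes z :: "real ^ 'n::finite"
  assumes "0 \<le> z $ k" "t > 0" "\<rho> \<le> 1"
  shows "0 < (norm (z + (t * \<rho>) *\<^sub>R axis k 1))\<^sup>2 \<or> 0 < t * (1 - \<rho>)"
proof (cases "\<rho> = 1")
  case True
  have "(z + t *\<^sub>R axis k 1) $ k \<noteq> 0"
    using assms by (simp add: axis_def)
  then have "z + t *\<^sub>R axis k 1 \<noteq> 0"
    by (metis zero_index)
  then show ?thesis using True by simp
qed (use assms in auto)

lemma continuous_on_ray_integrand:
  fixes f :: "'a::topological_space \<Rightarrow> real ^ 'n::finite"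
  assumes "continuous_on S f" "continuous_on S \<tau>" "continuous_on S \<rho>"
    and "\<And>p. p \<in> S \<Longrightarrow> 0 \<le> f p $ k" "\<And>p. p \<in> S \<Longrightarrow> \<tau> p > 0" "\<And>p. p \<in> S \<Longrightarrow> \<rho> p \<le> 1"
  shows "continuous_on S (\<lambda>p. heat_phi m ((norm (f p + (\<tau> p * \<rho> p) *\<^sub>R axis k 1))\<^sup>2) (\<tau> p * (1 - \<rho> p)))"
  using assms by (intro continuous_intros ray_point_pos) auto

lemma ray_integrand_integrable:
  fixes z :: "real ^ 'n::finite"
  assumes "0 \<le> z $ k" "t > 0" "continuous_on {0..1} g"
  shows "(\<lambda>\<rho>. g \<rho> * heat_phi m ((norm (z + (t * \<rho>) *\<^sub>R axis k 1))\<^sup>2) (t * (1 - \<rho>)))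
           integrable_on {0..1}"
  using assms by (intro integrable_continuous_real continuous_on_mult continuous_on_ray_integrand)
    (auto intro!: continuous_intros)

text \<open>For \<open>i \<noteq> k\<close> the inner derivative \<open>z $ i\<close> is constant
  along the ray and leaves the integral; for \<open>i = k\<close> it is the factor
  \<open>z $ k + t * \<rho>\<close>, whose power is counted by \<open>j\<close>. Restricting
  \<open>u\<close> to the closed half-space gives a one-sided normal derivative at the boundary and
  ordinary derivatives in the interior from the same formula.\<close>

lemma ray_integral_deriv_axis:
  fixes z :: "real ^ 'n::finite"
  assumes z: "0 \<le> z $ k" and t: "t > 0"
  shows "((\<lambda>u. ray_integral k j m (z + u *\<^sub>R axis i 1) t) has_real_derivative
      (if i = k then real j * ray_integral k (j - 1) m z t - ray_integral k (j + 1) (m + 1) z t / 2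
       else - (z $ i) / 2 * ray_integral k j (m + 1) z t))
      (at 0 within {u. 0 \<le> (z + u *\<^sub>R axis i 1) $ k})"
proof -
  define U where "U = {u. 0 \<le> (z + u *\<^sub>R axis i 1) $ k}"
  let ?w = "\<lambda>u. z + u *\<^sub>R axis i 1"
  let ?R = "\<lambda>u \<rho>. (norm (?w u + (t * \<rho>) *\<^sub>R axis k 1))\<^sup>2"
  let ?f = "\<lambda>u \<rho>. (?w u $ k + t * \<rho>) ^ j * heat_phi m (?R u \<rho>) (t * (1 - \<rho>))"
  \<comment> \<open>\<open>of_bool (i = k)\<close> merges the two cases of the claim; for
    \<open>j = 0\<close> the factor \<open>real j\<close> removes the term with the truncated
    exponent \<open>j - 1\<close>.\<close>
  define f' where "f' = (\<lambda>u \<rho>. of_bool (i = k) * real j * ((?w u $ k + t * \<rho>) ^ (j - 1) * heat_phi m (?R u \<rho>) (t * (1 - \<rho>)))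
     - 1 / 2 * ((?w u + (t * \<rho>) *\<^sub>R axis k 1) $ i * (?w u $ k + t * \<rho>) ^ j * heat_phi (m + 1) (?R u \<rho>) (t * (1 - \<rho>))))"
  have "((\<lambda>u. integral (cbox 0 1) (?f u)) has_field_derivative integral (cbox 0 1) (f' 0)) (at 0 within U)"
  proof (rule leibniz_rule_field_derivative)
    fix u \<rho> :: real
    have "((\<lambda>u. ?R u \<rho>) has_real_derivative 2 * (?w u + (t * \<rho>) *\<^sub>R axis k 1) $ i) (at u within U)"
    proof -
      have "?R v \<rho> = (norm (z + (t * \<rho>) *\<^sub>R axis k 1))\<^sup>2 + 2 * v * (z + (t * \<rho>) *\<^sub>R axis k 1) $ i + v\<^sup>2" for v
        using norm_add_axis[of "z + (t * \<rho>) *\<^sub>R axis k 1" v i] by (simp add: algebra_simps)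
      then show ?thesis
        by (auto intro!: derivative_eq_intros simp: axis_def)
    qed
    from DERIV_heat_phi_space[OF this, of m "t * (1 - \<rho>)"]
    show "((\<lambda>u. ?f u \<rho>) has_field_derivative f' u \<rho>) (at u within U)"
      unfolding f'_def
      by (auto intro!: derivative_eq_intros simp: axis_def algebra_simps)
  next
    fix u assume "u \<in> U"
    then show "?f u integrable_on cbox 0 1"
      unfolding cbox_interval using t
      by (intro ray_integrand_integrable) (auto simp: U_def intro!: continuous_intros)
  next
    show "continuous_on (U \<times> cbox 0 1) (\<lambda>(u, \<rho>). f' u \<rho>)"
      unfolding f'_def split_beta using t
      by (intro continuous_on_diff continuous_on_mult continuous_on_ray_integrand)
        (auto simp: U_def intro!: continuous_intros)
    show "0 \<in> U" using z by (simp add: U_def)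
    show "convex U"
    proof (cases "i = k")
      case True
      then have "U = {- z $ k..}" by (auto simp: U_def axis_def)
      then show ?thesis by simp
    next
      case False
      then have "U = UNIV" using z by (auto simp: U_def axis_def)
      then show ?thesis by simp
    qed
  qed
  moreover have "integral {0..1} (f' 0) =
    of_bool (i = k) * real j * ray_integral k (j - 1) m z t
    - 1 / 2 * integral {0..1} (\<lambda>\<rho>. ((z + (t * \<rho>) *\<^sub>R axis k 1) $ i * (z $ k + t * \<rho>) ^ j) *
        heat_phi (m + 1) ((norm (z + (t * \<rho>) *\<^sub>R axis k 1))\<^sup>2) (t * (1 - \<rho>)))" (is "_ = ?r")
    unfolding f'_def ray_integral_def using z t
    by (subst integral_diff)
      (auto intro!: integrable_on_mult_right ray_integrand_integrable continuous_intros simp del: vector_add_component)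
  moreover have "?r = (if i = k then real j * ray_integral k (j - 1) m z t - ray_integral k (j + 1) (m + 1) z t / 2
       else - (z $ i) / 2 * ray_integral k j (m + 1) z t)"
    by (auto simp: ray_integral_def axis_def mult.assoc)
  ultimately show ?thesis
    by (simp add: ray_integral_def U_def)
qed

text \<open>
  The ray integral of \<open>\<partial>\<^sub>s (z\<^sub>N heat_phi m (|z|\<^sup>2) s)\<close>, written without an integral sign
  so that it can be matched with the spatial derivatives of \<^const>\<open>ray_integral\<close>.
\<close>

definition ray_source :: "'n::finite \<Rightarrow> real \<Rightarrow> real ^ 'n \<Rightarrow> real \<Rightarrow> real" where
  "ray_source k m z t = - m * ray_integral k 1 (m + 1) z t
     + ((norm z)\<^sup>2 - (z $ k)\<^sup>2) / 4 * ray_integral k 1 (m + 2) z t + ray_integral k 3 (m + 2) z t / 4"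

text \<open>Only the \<open>k\<close>-th component moves along the ray, so the squared norm is a
  constant tangential part plus the square of that component; the square raises the power from 1 to
  3.\<close>

lemma ray_source_eq:
  fixes z :: "real ^ 'n::finite"
  assumes z: "0 \<le> z $ k" and t: "t > 0"
  shows "((\<lambda>\<rho>. (z $ k + t * \<rho>) *
      (- m * heat_phi (m + 1) ((norm (z + (t * \<rho>) *\<^sub>R axis k 1))\<^sup>2) (t * (1 - \<rho>))
       + (norm (z + (t * \<rho>) *\<^sub>R axis k 1))\<^sup>2 / 4
         * heat_phi (m + 2) ((norm (z + (t * \<rho>) *\<^sub>R axis k 1))\<^sup>2) (t * (1 - \<rho>))))
      has_integral ray_source k m z t) {0..1}"
proof -
  have *: "((\<lambda>\<rho>. (z $ k + t * \<rho>) ^ j * heat_phi m ((norm (z + (t * \<rho>) *\<^sub>R axis k 1))\<^sup>2) (t * (1 - \<rho>)))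
      has_integral ray_integral k j m z t) {0..1}" for j m
    unfolding ray_integral_def using z t
    by (intro integrable_integral ray_integrand_integrable) (auto intro!: continuous_intros)
  have R: "(norm (z + (t * \<rho>) *\<^sub>R axis k 1))\<^sup>2 = ((norm z)\<^sup>2 - (z $ k)\<^sup>2) + (z $ k + t * \<rho>)\<^sup>2" for \<rho>
    unfolding norm_add_axis by (simp add: power2_eq_square algebra_simps)
  have alg: "- m * (a ^ 1 * p) + d / 4 * (a ^ 1 * q) + a ^ 3 * q / 4 = a * (- m * p + (d + a\<^sup>2) / 4 * q)"
    for a p q d :: real
    by (simp add: field_simps power2_eq_square power3_eq_cube)
  show ?thesis
    unfolding ray_source_def
    by (rule has_integral_eq[rotated],
        rule has_integral_add[OF has_integral_add[OF has_integral_mult_right[OF *, of "-m" 1 "m + 1"]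
         has_integral_mult_right[OF *, of "((norm z)\<^sup>2 - (z $ k)\<^sup>2) / 4" 1 "m + 2"]]
         has_integral_divide[OF *, of 3 "m + 2" 4]])
      (simp only: R alg)
qed

lemma ray_norm_deriv:
  fixes z :: "real ^ 'n::finite"
  assumes "(f has_real_derivative D) (at x within X)"
  shows "((\<lambda>x. (norm (z + f x *\<^sub>R axis k 1))\<^sup>2) has_real_derivative (2 * D * (z $ k + f x))) (at x within X)"
  unfolding norm_add_axis
  by (auto intro!: derivative_eq_intros assms simp: algebra_simps)

text \<open>Along the ray the point moves at speed \<open>t\<close> in direction
  \<open>e\<^sub>N\<close> while the time argument falls at rate \<open>t\<close>, so the
  \<open>\<rho>\<close>-derivative is \<open>t\<close> times
  \<open>\<partial>\<^sub>N - \<partial>\<^sub>s\<close>. Of the end values of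
  \<open>z\<^sub>N heat_phi\<close>, the one at \<open>\<rho> = 1\<close> is 0 and the one at
  \<open>\<rho> = 0\<close> is the first term on the right. The bracket is the normal derivative of
  \<open>ray_integral k 1 m\<close>, so for \<open>m = N/2 + 1\<close> this is the transport
  equation for \<open>H\<close>.\<close>

lemma ray_source_identity:
  fixes z :: "real ^ 'n::finite"
  assumes z: "0 \<le> z $ k" and t: "t > 0"
  shows "t * ray_source k m z t = z $ k * heat_phi m ((norm z)\<^sup>2) t
    + t * (ray_integral k 0 m z t - ray_integral k 2 (m + 1) z t / 2)"
proof -
  let ?R = "\<lambda>\<rho>. (norm (z + (t * \<rho>) *\<^sub>R axis k 1))\<^sup>2"
  let ?p = "\<lambda>m \<rho>. heat_phi m (?R \<rho>) (t * (1 - \<rho>))"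
  let ?a = "\<lambda>\<rho>. z $ k + t * \<rho>"
  have "((\<lambda>\<rho>. t * ?p m \<rho> + ?a \<rho> * (- (2 * t * ?a \<rho> / 4) * ?p (m + 1) \<rho>
      + (- t) * (- m * ?p (m + 1) \<rho> + ?R \<rho> / 4 * ?p (m + 2) \<rho>))) has_integral
      (?a 1 * ?p m 1 - ?a 0 * ?p m 0)) {0..1}"
  \<comment> \<open>At \<open>\<rho> = 1\<close> the time argument is 0 and only continuity is
    available, hence the version with derivatives in the open interval.\<close>
  proof (rule fundamental_theorem_of_calculus_interior)
    show "continuous_on {0..1} (\<lambda>\<rho>. ?a \<rho> * ?p m \<rho>)"
      using z t by (intro continuous_on_mult continuous_on_ray_integrand) (auto intro!: continuous_intros)
    fix \<rho> :: real assume "\<rho> \<in> {0<..<1}"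
    then have "((\<lambda>\<rho>. ?p m \<rho>) has_real_derivative (- (2 * t * ?a \<rho> / 4) * ?p (m + 1) \<rho>
      + (- t) * (- m * ?p (m + 1) \<rho> + ?R \<rho> / 4 * ?p (m + 2) \<rho>))) (at \<rho>)"
      using t by (intro DERIV_heat_phi ray_norm_deriv) (auto intro!: derivative_eq_intros)
    then show "((\<lambda>\<rho>. ?a \<rho> * ?p m \<rho>) has_vector_derivative t * ?p m \<rho> + ?a \<rho> * (- (2 * t * ?a \<rho> / 4) * ?p (m + 1) \<rho>
      + (- t) * (- m * ?p (m + 1) \<rho> + ?R \<rho> / 4 * ?p (m + 2) \<rho>))) (at \<rho>)"
      unfolding has_real_derivative_iff_has_vector_derivative[symmetric]
      by (auto intro!: derivative_eq_intros)
  qed simp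
  moreover
  have *: "((\<lambda>\<rho>. ?a \<rho> ^ j * ?p m \<rho>) has_integral ray_integral k j m z t) {0..1}" for j m
    unfolding ray_integral_def using z t
    by (intro integrable_integral ray_integrand_integrable) (auto intro!: continuous_intros)
  have "((\<lambda>\<rho>. t * ?p m \<rho> + ?a \<rho> * (- (2 * t * ?a \<rho> / 4) * ?p (m + 1) \<rho>
      + (- t) * (- m * ?p (m + 1) \<rho> + ?R \<rho> / 4 * ?p (m + 2) \<rho>))) has_integral
      (t * (ray_integral k 0 m z t - ray_integral k 2 (m + 1) z t / 2) - t * ray_source k m z t)) {0..1}"
    by (rule has_integral_eq[rotated], rule has_integral_diff[OF
          has_integral_mult_right[OF has_integral_diff[OF *[of 0 m] has_integral_divide[OF *[of 2 "m + 1"], of 2]]]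
          has_integral_mult_right[OF ray_source_eq[OF z t, of m]]])
      (simp add: algebra_simps power2_eq_square)
  ultimately have "?a 1 * ?p m 1 - ?a 0 * ?p m 0
    = t * (ray_integral k 0 m z t - ray_integral k 2 (m + 1) z t / 2) - t * ray_source k m z t"
    by (rule has_integral_unique)
  then show ?thesis
    by (simp add: algebra_simps)
qed

text \<open>Write the integrand as \<open>F = f(t * \<rho>, t * (1 - \<rho>))\<close>. Then
  \<open>\<partial>\<^sub>t (t F) = F + t \<rho> \<partial>\<^sub>1 f + t (1 - \<rho>)
  \<partial>\<^sub>2 f\<close> (this is \<open>f'\<close>), while \<open>\<partial>\<^sub>\<rho>
  (\<rho> F) = F + t \<rho> (\<partial>\<^sub>1 f - \<partial>\<^sub>2 f)\<close> (this is
  \<open>g'\<close>). They differ by \<open>t \<partial>\<^sub>2 f\<close>, and \<open>g'\<close>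
  integrates to 0 because \<open>\<rho> F\<close> vanishes at both ends. What remains is a
  derivative in the time slot alone, which the heat equation turns into a Laplacian.\<close>

lemma ray_integral_deriv_time:
  fixes z :: "real ^ 'n::finite"
  assumes z: "0 \<le> z $ k" and t: "t > 0"
  shows "((\<lambda>t. t * ray_integral k 1 m z t) has_real_derivative t * ray_source k m z t) (at t)"
proof -
  let ?R = "\<lambda>t \<rho>. (norm (z + (t * \<rho>) *\<^sub>R axis k 1))\<^sup>2"
  let ?p = "\<lambda>m t \<rho>. heat_phi m (?R t \<rho>) (t * (1 - \<rho>))"
  let ?a = "\<lambda>t \<rho>. z $ k + t * \<rho>"
  let ?f = "\<lambda>t \<rho>. t * ?a t \<rho> * ?p m t \<rho>"
  define f' where "f' = (\<lambda>t \<rho>. (?a t \<rho> + t * \<rho>) * ?p m t \<rho> +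
     (- (2 * \<rho> * ?a t \<rho> / 4) * ?p (m + 1) t \<rho>
      + (1 - \<rho>) * (- m * ?p (m + 1) t \<rho> + ?R t \<rho> / 4 * ?p (m + 2) t \<rho>)) * (t * ?a t \<rho>))"
  define g' where "g' = (\<lambda>\<rho>. (?a t \<rho> + t * \<rho>) * ?p m t \<rho> +
     (- (2 * t * ?a t \<rho> / 4) * ?p (m + 1) t \<rho>
      + (- t) * (- m * ?p (m + 1) t \<rho> + ?R t \<rho> / 4 * ?p (m + 2) t \<rho>)) * (\<rho> * ?a t \<rho>))"
  have "((\<lambda>t. integral (cbox 0 1) (?f t)) has_field_derivative integral (cbox 0 1) (f' t)) (at t within {0<..})"
  proof (rule leibniz_rule_field_derivative)
    fix t \<rho> :: real assume *: "t \<in> {0<..}" "\<rho> \<in> cbox 0 1"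
    have "((\<lambda>t. ?p m t \<rho>) has_real_derivative (- (2 * \<rho> * ?a t \<rho> / 4) * ?p (m + 1) t \<rho>
      + (1 - \<rho>) * (- m * ?p (m + 1) t \<rho> + ?R t \<rho> / 4 * ?p (m + 2) t \<rho>))) (at t within {0<..})"
    \<comment> \<open>At \<open>\<rho> = 1\<close> the time argument is 0 for every
      \<open>t\<close>, so the function and its claimed derivative are both identically 0.\<close>
    proof (cases "\<rho> = 1")
      case False
      then show ?thesis using * by (intro DERIV_heat_phi ray_norm_deriv) (auto intro!: derivative_eq_intros)
    qed auto
    then show "((\<lambda>t. ?f t \<rho>) has_field_derivative f' t \<rho>) (at t within {0<..})"
      unfolding f'_def by (intro DERIV_mult) (auto intro!: derivative_eq_intros)
  next
    fix u :: real assume "u \<in> {0<..}"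
    then show "?f u integrable_on cbox 0 1"
      unfolding cbox_interval using z
      by (intro ray_integrand_integrable) (auto intro!: continuous_intros)
  next
    show "continuous_on ({0<..} \<times> cbox 0 1) (\<lambda>(u, \<rho>). f' u \<rho>)"
      unfolding f'_def split_beta using z
      by (intro continuous_on_diff continuous_on_mult continuous_on_add continuous_on_ray_integrand)
        (auto intro!: continuous_intros)
  qed (use t in auto)
  then have 1: "((\<lambda>t. t * ray_integral k 1 m z t) has_real_derivative integral {0..1} (f' t)) (at t)"
    using t by (simp add: at_within_open[of t "{0<..}"] ray_integral_def mult.assoc)
  have "(g' has_integral (1 * ?a t 1 * ?p m t 1 - 0 * ?a t 0 * ?p m t 0)) {0..1}"
  proof (rule fundamental_theorem_of_calculus_interior)
    show "continuous_on {0..1} (\<lambda>\<rho>. \<rho> * ?a t \<rho> * ?p m t \<rho>)"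
      using z t by (intro continuous_on_mult continuous_on_ray_integrand) (auto intro!: continuous_intros)
    fix \<rho> :: real assume "\<rho> \<in> {0<..<1}"
    then have "((\<lambda>\<rho>. ?p m t \<rho>) has_real_derivative (- (2 * t * ?a t \<rho> / 4) * ?p (m + 1) t \<rho>
      + (- t) * (- m * ?p (m + 1) t \<rho> + ?R t \<rho> / 4 * ?p (m + 2) t \<rho>))) (at \<rho>)"
      using t by (intro DERIV_heat_phi ray_norm_deriv) (auto intro!: derivative_eq_intros)
    then show "((\<lambda>\<rho>. \<rho> * ?a t \<rho> * ?p m t \<rho>) has_vector_derivative g' \<rho>) (at \<rho>)"
      unfolding has_real_derivative_iff_has_vector_derivative[symmetric] g'_def
      by (intro DERIV_mult) (auto intro!: derivative_eq_intros)
  qed simp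
  then have "(g' has_integral 0) {0..1}" by simp
  have alg: "(c * p + (- (2 * t * a / 4) * p1 + (- t) * (- m * p1 + R / 4 * p2)) * (\<rho> * a))
      + t * (a * (- m * p1 + R / 4 * p2)) =
    c * p + (- (2 * \<rho> * a / 4) * p1 + (1 - \<rho>) * (- m * p1 + R / 4 * p2)) * (t * a)"
    for c p p1 p2 \<rho> a R :: real
    by (simp add: field_simps)
  from has_integral_add[OF \<open>(g' has_integral 0) {0..1}\<close> has_integral_mult_right[OF ray_source_eq[OF z t, of m], of t]]
  have "(f' t has_integral t * ray_source k m z t) {0..1}"
    unfolding f'_def g'_def by (simp only: alg add_0_left)
  then show ?thesis
    using 1 by (simp add: integral_unique)
qed

section \<open>Laplacians\<close>

lemma has_partial_deriv_cong:
  assumes "\<forall>\<^sub>F z in nhds x. u z = v z"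
  shows "has_partial_deriv i u d x \<longleftrightarrow> has_partial_deriv i v d x"
proof -
  have "((\<lambda>s. x + s *\<^sub>R axis i 1) \<longlongrightarrow> x + 0 *\<^sub>R axis i 1) (nhds (0::real))"
    by (intro tendsto_intros filterlim_ident)
  then have "\<forall>\<^sub>F s in nhds (0::real). u (x + s *\<^sub>R axis i 1) = v (x + s *\<^sub>R axis i 1)"
    using assms by (auto simp: filterlim_iff)
  then show ?thesis
    unfolding has_partial_deriv_def by (intro DERIV_cong_ev) auto
qed

lemma has_laplacian_cong:
  assumes ev: "\<forall>\<^sub>F z in nhds x. u z = v z" and "has_laplacian v L x"
  shows "has_laplacian u L x"
proof -
  from assms obtain v' w where v': "\<And>i. \<forall>\<^sub>F z in nhds x. has_partial_deriv i v (v' i z) z"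
    and w: "\<And>i. has_partial_deriv i (v' i) (w i) x" "L = (\<Sum>i\<in>UNIV. w i)"
    unfolding has_laplacian_def by blast
  \<comment> \<open>\<open>has_laplacian\<close> asks for first derivatives at all points near
    \<open>x\<close>, so the equality is needed in a neighbourhood of each of these points.\<close>
  have "\<forall>\<^sub>F z in nhds x. \<forall>\<^sub>F y in nhds z. u y = v y"
    using ev by (simp add: eventually_eventually)
  then have "\<forall>\<^sub>F z in nhds x. has_partial_deriv i u (v' i z) z" for i
    using v'[of i]
    by eventually_elim (simp add: has_partial_deriv_cong)
  then show ?thesis
    unfolding has_laplacian_def using w by blast
qed

lemma has_laplacian_add:
  assumes "has_laplacian u L x" "has_laplacian v M x"
  shows "has_laplacian (\<lambda>x. u x + v x) (L + M) x"
proof -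
  from assms(1) obtain u' u'' where u: "\<And>i. \<forall>\<^sub>F z in nhds x. has_partial_deriv i u (u' i z) z"
    "\<And>i. has_partial_deriv i (u' i) (u'' i) x" "L = (\<Sum>i\<in>UNIV. u'' i)"
    unfolding has_laplacian_def by blast
  from assms(2) obtain v' v'' where v: "\<And>i. \<forall>\<^sub>F z in nhds x. has_partial_deriv i v (v' i z) z"
    "\<And>i. has_partial_deriv i (v' i) (v'' i) x" "M = (\<Sum>i\<in>UNIV. v'' i)"
    unfolding has_laplacian_def by blast
  have "\<forall>\<^sub>F z in nhds x. has_partial_deriv i (\<lambda>x. u x + v x) (u' i z + v' i z) z" for i
    using u(1)[of i] v(1)[of i]
    by eventually_elim (auto simp: has_partial_deriv_def intro: DERIV_add)
  moreover have "has_partial_deriv i (\<lambda>x. u' i x + v' i x) (u'' i + v'' i) x" for i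
    using u(2)[of i] v(2)[of i] by (auto simp: has_partial_deriv_def intro: DERIV_add)
  ultimately show ?thesis
    unfolding has_laplacian_def
    by (intro exI[of _ "\<lambda>i z. u' i z + v' i z"] exI[of _ "\<lambda>i. u'' i + v'' i"])
      (auto simp: u(3) v(3) sum.distrib)
qed

lemma has_laplacian_cmult:
  assumes "has_laplacian u L x"
  shows "has_laplacian (\<lambda>x. c * u x) (c * L) x"
proof -
  from assms obtain u' u'' where u: "\<And>i. \<forall>\<^sub>F z in nhds x. has_partial_deriv i u (u' i z) z"
    "\<And>i. has_partial_deriv i (u' i) (u'' i) x" "L = (\<Sum>i\<in>UNIV. u'' i)"
    unfolding has_laplacian_def by blast
  have "\<forall>\<^sub>F z in nhds x. has_partial_deriv i (\<lambda>x. c * u x) (c * u' i z) z" for i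
    using u(1)[of i]
    by eventually_elim (auto simp: has_partial_deriv_def intro: DERIV_cmult)
  moreover have "has_partial_deriv i (\<lambda>x. c * u' i x) (c * u'' i) x" for i
    using u(2)[of i] by (auto simp: has_partial_deriv_def intro: DERIV_cmult)
  ultimately show ?thesis
    unfolding has_laplacian_def
    by (intro exI[of _ "\<lambda>i z. c * u' i z"] exI[of _ "\<lambda>i. c * u'' i"])
      (auto simp: u(3) sum_distrib_left)
qed

lemma has_laplacian_shift:
  assumes "has_laplacian u L (x - c)"
  shows "has_laplacian (\<lambda>x. u (x - c)) L x"
proof -
  from assms obtain u' u'' where u: "\<And>i. \<forall>\<^sub>F z in nhds (x - c). has_partial_deriv i u (u' i z) z"
    "\<And>i. has_partial_deriv i (u' i) (u'' i) (x - c)" "L = (\<Sum>i\<in>UNIV. u'' i)"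
    unfolding has_laplacian_def by blast
  have "((\<lambda>z. z - c) \<longlongrightarrow> x - c) (nhds x)"
    by (intro tendsto_intros filterlim_ident)
  then have "\<forall>\<^sub>F z in nhds x. has_partial_deriv i u (u' i (z - c)) (z - c)" for i
    using u(1)[of i] by (auto simp: filterlim_iff)
  moreover have "has_partial_deriv i (\<lambda>z. f (z - c)) d z \<longleftrightarrow> has_partial_deriv i f d (z - c)" for i f d z
    unfolding has_partial_deriv_def by (simp add: algebra_simps)
  ultimately show ?thesis
    unfolding has_laplacian_def using u(2,3)
    by (intro exI[of _ "\<lambda>i z. u' i (z - c)"] exI[of _ "u''"]) auto
qed

lemma norm_sq_eq_sum: "(norm z)\<^sup>2 = (\<Sum>i\<in>UNIV. (z $ i)\<^sup>2)" for z :: "real ^ 'n::finite"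
  unfolding power2_norm_eq_inner inner_vec_def by (simp add: power2_eq_square)

lemma has_partial_deriv_heat_phi:
  "has_partial_deriv i (\<lambda>z. heat_phi m ((norm z)\<^sup>2) t) (- (z $ i) / 2 * heat_phi (m + 1) ((norm z)\<^sup>2) t) z"
proof -
  have "((\<lambda>s. (norm (z + s *\<^sub>R axis i 1))\<^sup>2) has_real_derivative (2 * z $ i)) (at 0)"
    using ray_norm_deriv[OF DERIV_ident, of z i 0 UNIV] by simp
  from DERIV_heat_phi_space[OF this, of m t] show ?thesis
    by (simp add: has_partial_deriv_def field_simps)
qed

text \<open>For \<open>m = N/2\<close> the value coincides with the derivative in the time argument
  in \<open>DERIV_heat_phi\<close>: this is the heat equation for the Gauss kernel.\<close>

lemma has_laplacian_heat_phi:
  fixes z :: "real ^ 'n::finite"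
  shows "has_laplacian (\<lambda>z. heat_phi m ((norm z)\<^sup>2) t)
    (- (real CARD('n) / 2) * heat_phi (m + 1) ((norm z)\<^sup>2) t + (norm z)\<^sup>2 / 4 * heat_phi (m + 2) ((norm z)\<^sup>2) t) z"
  unfolding has_laplacian_def
proof (intro exI conjI allI)
  let ?w = "\<lambda>i. - (1 / 2) * heat_phi (m + 1) ((norm z)\<^sup>2) t + (z $ i)\<^sup>2 / 4 * heat_phi (m + 2) ((norm z)\<^sup>2) t"
  fix i
  show "\<forall>\<^sub>F z in nhds z. has_partial_deriv i (\<lambda>z. heat_phi m ((norm z)\<^sup>2) t)
     ((\<lambda>i z. - (z $ i) / 2 * heat_phi (m + 1) ((norm z)\<^sup>2) t) i z) z"
    by (intro always_eventually allI) (simp only: has_partial_deriv_heat_phi)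
  have "((\<lambda>s. (- ((z + s *\<^sub>R axis i 1) $ i) / 2) * heat_phi (m + 1) ((norm (z + s *\<^sub>R axis i 1))\<^sup>2) t)
    has_real_derivative ?w i) (at 0)"
    by (rule DERIV_cong[OF DERIV_mult[OF _ has_partial_deriv_heat_phi[unfolded has_partial_deriv_def]]])
      (auto intro!: derivative_eq_intros simp: power2_eq_square add.commute[of m 2])
  then show "has_partial_deriv i ((\<lambda>i z. - (z $ i) / 2 * heat_phi (m + 1) ((norm z)\<^sup>2) t) i) (?w i) z"
    unfolding has_partial_deriv_def .
next
  show "- (real CARD('n) / 2) * heat_phi (m + 1) ((norm z)\<^sup>2) t + (norm z)\<^sup>2 / 4 * heat_phi (m + 2) ((norm z)\<^sup>2) t =
    (\<Sum>i\<in>UNIV. - (1 / 2) * heat_phi (m + 1) ((norm z)\<^sup>2) t + (z $ i)\<^sup>2 / 4 * heat_phi (m + 2) ((norm z)\<^sup>2) t)"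
    unfolding sum.distrib sum_distrib_right[symmetric] sum_divide_distrib[symmetric] norm_sq_eq_sum[symmetric]
    by simp
qed

lemma has_partial_deriv_ray_integral:
  fixes z :: "real ^ 'n::finite"
  assumes z: "0 < z $ k" and t: "t > 0"
  shows "has_partial_deriv i (\<lambda>z. ray_integral k j m z t)
      (if i = k then real j * ray_integral k (j - 1) m z t - ray_integral k (j + 1) (m + 1) z t / 2
       else - (z $ i) / 2 * ray_integral k j (m + 1) z t) z"
proof -
  let ?U = "{u. 0 < (z + u *\<^sub>R axis i 1) $ k}"
  have "open ?U"
    by (intro open_Collect_less continuous_intros)
  moreover have "0 \<in> ?U" using z by simp
  ultimately have *: "at 0 within ?U = at 0" by (intro at_within_open)
  show ?thesis
    unfolding has_partial_deriv_def
    by (rule DERIV_subset[OF ray_integral_deriv_axis[OF less_imp_le[OF z] t], of "?U", unfolded *]) auto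
qed

text \<open>The coefficient of \<open>ray_integral k 1 (m + 1)\<close> receives \<open>- 3/2\<close>
  from direction \<open>k\<close> and \<open>- 1/2\<close> from each of the other
  \<open>N - 1\<close> directions, in total \<open>- (N/2 + 1)\<close>. It has to be
  \<open>- m\<close>, which fixes \<open>m\<close>. The Laplacian then acts as the time derivative
  of the integrand, since \<open>\<partial>\<^sub>N \<Gamma>\<close> solves the heat
  equation.\<close>

lemma has_laplacian_ray_integral:
  fixes z :: "real ^ 'n::finite"
  assumes z: "0 < z $ k" and t: "t > 0" and m: "m = real CARD('n) / 2 + 1"
  shows "has_laplacian (\<lambda>z. ray_integral k 1 m z t) (ray_source k m z t) z"
  unfolding has_laplacian_def
proof (intro exI conjI allI)
  let ?v = "\<lambda>i z. if i = k then ray_integral k 0 m z t - ray_integral k 2 (m + 1) z t / 2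
       else - (z $ i) / 2 * ray_integral k 1 (m + 1) z t"
  let ?w = "\<lambda>i. if i = k then - ray_integral k 1 (m + 1) z t / 2
        - (2 * ray_integral k 1 (m + 1) z t - ray_integral k 3 (m + 2) z t / 2) / 2
       else - (1 / 2) * ray_integral k 1 (m + 1) z t + (z $ i)\<^sup>2 / 4 * ray_integral k 1 (m + 2) z t"
  fix i
  have "open {z :: real ^ 'n. 0 < z $ k}" by (rule open_halfspace_component_gt_cart)
  then have "\<forall>\<^sub>F z in nhds z. z \<in> {z. 0 < z $ k}"
    using z by (intro eventually_nhds_in_open) auto
  then show "\<forall>\<^sub>F z in nhds z. has_partial_deriv i (\<lambda>z. ray_integral k 1 m z t) (?v i z) z"
  proof eventually_elim
    case (elim z)
    then show ?case
      using has_partial_deriv_ray_integral[of z k t i 1 m] t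
      by (cases "i = k") (simp_all add: numeral_2_eq_2)
  qed
  show "has_partial_deriv i (?v i) (?w i) z"
  proof (cases "i = k")
    case True
    have "((\<lambda>s. ray_integral k 0 m (z + s *\<^sub>R axis k 1) t - ray_integral k 2 (m + 1) (z + s *\<^sub>R axis k 1) t / 2)
      has_real_derivative ?w k) (at 0)"
      using DERIV_diff[OF has_partial_deriv_ray_integral[OF z t, of k 0 m, unfolded has_partial_deriv_def]
          DERIV_cdivide[OF has_partial_deriv_ray_integral[OF z t, of k 2 "m + 1", unfolded has_partial_deriv_def], of 2]]
      by (simp add: numeral_3_eq_3 add.commute)
    then show ?thesis using True by (simp add: has_partial_deriv_def)
  next
    case False
    have "((\<lambda>s. (- ((z + s *\<^sub>R axis i 1) $ i) / 2) * ray_integral k 1 (m + 1) (z + s *\<^sub>R axis i 1) t)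
      has_real_derivative ?w i) (at 0)"
      using False
      by (intro DERIV_cong[OF DERIV_mult[OF _ has_partial_deriv_ray_integral[OF z t, unfolded has_partial_deriv_def]]])
        (auto intro!: derivative_eq_intros simp: power2_eq_square add.commute[of m 2])
    then show ?thesis using False unfolding has_partial_deriv_def by (simp only: if_False)
  qed
next
  have *: "(\<Sum>i\<in>UNIV. f i) = f k + (\<Sum>i\<in>UNIV - {k}. f i)" for f :: "'n \<Rightarrow> real"
    by (simp add: sum.remove)
  have "(norm z)\<^sup>2 - (z $ k)\<^sup>2 = (\<Sum>i\<in>UNIV - {k}. (z $ i)\<^sup>2)"
    unfolding norm_sq_eq_sum * by simp
  then have "(\<Sum>i\<in>UNIV - {k}. if i = k then - ray_integral k 1 (m + 1) z t / 2
        - (2 * ray_integral k 1 (m + 1) z t - ray_integral k 3 (m + 2) z t / 2) / 2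
       else - (1 / 2) * ray_integral k 1 (m + 1) z t + (z $ i)\<^sup>2 / 4 * ray_integral k 1 (m + 2) z t)
     = (real CARD('n) - 1) * (- (1 / 2) * ray_integral k 1 (m + 1) z t)
       + ((norm z)\<^sup>2 - (z $ k)\<^sup>2) / 4 * ray_integral k 1 (m + 2) z t" (is "sum ?f _ = ?r")
    by (simp add: sum.distrib sum_subtractf sum_distrib_right sum_divide_distrib card_Diff_singleton of_nat_diff Suc_leI)
  then show "ray_source k m z t = (\<Sum>i\<in>UNIV. ?f i)"
    unfolding * ray_source_def by (simp add: m field_simps)
qed

section \<open>The kernels and the equations they satisfy\<close>

text \<open>\<open>dipole = - 2 \<partial>\<^sub>N \<Gamma>\<close>, the integrand of \<open>H\<close> including its factor.\<close>

definition dipole :: "'n::finite \<Rightarrow> real ^ 'n \<Rightarrow> real \<Rightarrow> real" where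
  "dipole k w s = (4 * pi) powr (- (real CARD('n) / 2)) * (w $ k * heat_phi (real CARD('n) / 2 + 1) ((norm w)\<^sup>2) s)"

lemma gauss_kernel_eq:
  "t > 0 \<Longrightarrow> gauss_kernel w t = (4 * pi) powr (- (real CARD('n) / 2)) * heat_phi (real CARD('n) / 2) ((norm w)\<^sup>2) t"
  for w :: "real ^ 'n::finite"
  by (simp add: gauss_kernel_def heat_phi_def powr_mult)

lemma dipole_eq: "s > 0 \<Longrightarrow> dipole k w s = w $ k / s * gauss_kernel w s"
  by (simp add: dipole_def gauss_kernel_eq heat_phi_divide[symmetric])

lemma H_integrand_eq:
  assumes "\<tau> < t"
  shows "H_integrand k x y t \<tau> = - (1 / 2) * dipole k (x - reflect k y + \<tau> *\<^sub>R axis k 1) (t - \<tau>)"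
proof -
  let ?w = "x - reflect k y + \<tau> *\<^sub>R axis k 1"
  have s: "0 < t - \<tau>" using assms by simp
  have "((\<lambda>s. gauss_kernel (?w + s *\<^sub>R axis k 1) (t - \<tau>)) has_real_derivative - (1 / 2) * dipole k ?w (t - \<tau>)) (at 0)"
    unfolding gauss_kernel_eq[OF s]
    by (rule DERIV_cong[OF DERIV_cmult[OF has_partial_deriv_heat_phi[unfolded has_partial_deriv_def]]])
      (simp add: dipole_def del: vector_add_component vector_minus_component)
  then show ?thesis
    unfolding H_integrand_def partial_deriv_def by (rule DERIV_imp_deriv)
qed

lemma continuous_on_dipole_ray:
  assumes "0 \<le> z $ k" "t > 0"
  shows "continuous_on {0..t} (\<lambda>\<tau>. dipole k (z + \<tau> *\<^sub>R axis k 1) (t - \<tau>))"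
proof -
  have "0 < (norm (z + \<tau> *\<^sub>R axis k 1))\<^sup>2 \<or> 0 < t - \<tau>" if "\<tau> \<in> {0..t}" for \<tau>
    using ray_point_pos[OF assms, of "\<tau> / t"] that assms by (simp add: field_simps)
  then show ?thesis
    unfolding dipole_def by (intro continuous_intros) auto
qed

lemma set_integrable_dipole_ray:
  assumes "0 \<le> z $ k" "t > 0"
  shows "set_integrable lborel {0<..<t} (\<lambda>\<tau>. dipole k (z + \<tau> *\<^sub>R axis k 1) (t - \<tau>))"
  by (rule set_integrable_subset[OF borel_integrable_atLeastAtMost'[OF continuous_on_dipole_ray[OF assms]]]) auto

lemma reflect_eq: "reflect k y = y - (2 * y $ k) *\<^sub>R axis k 1"
  by (auto simp: reflect_def vec_eq_iff axis_def)

text \<open>The excess \<open>4 * (x $ k * y $ k)\<close> is symmetric in \<open>x\<close> and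
  \<open>y\<close>, which gives the symmetry of \<open>G\<close>, and it vanishes as soon as one
  point lies on the boundary, which removes the Dirichlet part there.\<close>

lemma norm_diff_reflect: "(norm (x - reflect k y))\<^sup>2 = (norm (x - y))\<^sup>2 + 4 * (x $ k * y $ k)"
  using norm_add_axis[of "x - y" "2 * y $ k" k]
  by (simp add: reflect_eq algebra_simps power2_eq_square)

lemma reflect_component [simp]: "reflect k y $ k = - y $ k"
  by (simp add: reflect_def)

lemma H_kernel_eq_LINT:
  "H_kernel k x y t = (LINT \<tau>:{0<..<t}|lborel. dipole k (x - reflect k y + \<tau> *\<^sub>R axis k 1) (t - \<tau>))"
proof -
  have "(LINT \<tau>:{0<..<t}|lborel. H_integrand k x y t \<tau>)
    = (LINT \<tau>:{0<..<t}|lborel. - (1 / 2) * dipole k (x - reflect k y + \<tau> *\<^sub>R axis k 1) (t - \<tau>))"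
    by (intro set_lebesgue_integral_cong) (auto simp: H_integrand_eq)
  then show ?thesis
    unfolding H_kernel_def by (simp only: set_integral_mult_right)
qed

lemma H_kernel_eq_ray_integral:
  fixes x y :: "real ^ 'n::finite"
  assumes "0 \<le> x $ k" "0 \<le> y $ k" "t > 0"
  shows "H_kernel k x y t = (4 * pi) powr (- (real CARD('n) / 2)) *
     (t * ray_integral k 1 (real CARD('n) / 2 + 1) (x - reflect k y) t)"
proof -
  let ?z = "x - reflect k y" and ?A = "(4 * pi) powr (- (real CARD('n) / 2))"
  let ?d = "\<lambda>\<tau>. dipole k (?z + \<tau> *\<^sub>R axis k 1) (t - \<tau>)"
  have z: "0 \<le> ?z $ k" using assms by simp
  have "H_kernel k x y t = integral {0<..<t} ?d"
    unfolding H_kernel_eq_LINT by (rule set_borel_integral_eq_integral(2)[OF set_integrable_dipole_ray[OF z \<open>t > 0\<close>]])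
  also have "\<dots> = integral {0..t} ?d"
    by (simp add: integral_open_interval_real)
  finally have H: "H_kernel k x y t = integral {0..t} ?d" .
  have "(?d has_integral H_kernel k x y t) {0..t}"
    unfolding H using continuous_on_dipole_ray[OF z \<open>t > 0\<close>]
    by (intro integrable_integral integrable_continuous_real)
  from has_integral_stretch_real[OF this, of t] assms(3)
  have "((\<lambda>\<rho>. ?d (t * \<rho>)) has_integral H_kernel k x y t / t) {0..1}"
    by simp
  from has_integral_mult_right[OF this, of t]
  have "((\<lambda>\<rho>. t * ?d (t * \<rho>)) has_integral H_kernel k x y t) {0..1}"
    using assms(3) by simp
  then have "integral {0..1} (\<lambda>\<rho>. (?A * t) * ((?z $ k + t * \<rho>) ^ 1 *
     heat_phi (real CARD('n) / 2 + 1) ((norm (?z + (t * \<rho>) *\<^sub>R axis k 1))\<^sup>2) (t * (1 - \<rho>)))) = H_kernel k x y t"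
    by (intro integral_unique) (simp add: dipole_def algebra_simps)
  then show ?thesis
    unfolding ray_integral_def integral_mult_right by (simp only: mult.assoc)
qed

section \<open>Time derivative, Laplacian and normal derivative of \<open>G\<close>\<close>

lemma G_kernel_eq:
  fixes x y :: "real ^ 'n::finite"
  assumes "0 \<le> x $ k" "0 \<le> y $ k" "t > 0"
  shows "G_kernel k x y t = (4 * pi) powr (- (real CARD('n) / 2)) *
     (heat_phi (real CARD('n) / 2) ((norm (x - y))\<^sup>2) t
      - heat_phi (real CARD('n) / 2) ((norm (x - reflect k y))\<^sup>2) t
      + t * ray_integral k 1 (real CARD('n) / 2 + 1) (x - reflect k y) t)"
  using assms by (simp add: G_kernel_def gauss_kernel_eq H_kernel_eq_ray_integral algebra_simps)

text \<open>The derivative is kept as three separate contributions, so that it can be compared term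
  by term with the Laplacian in the interior and with the normal derivative on the boundary.\<close>

lemma G_kernel_DERIV_time:
  fixes x y :: "real ^ 'n::finite"
  defines "m \<equiv> real CARD('n) / 2"
  assumes xy: "0 \<le> x $ k" "0 \<le> y $ k" and t: "t > 0"
  shows "((\<lambda>t. G_kernel k x y t) has_real_derivative (4 * pi) powr (- m) *
    ((- m * heat_phi (m + 1) ((norm (x - y))\<^sup>2) t
         + (norm (x - y))\<^sup>2 / 4 * heat_phi (m + 2) ((norm (x - y))\<^sup>2) t)
     - (- m * heat_phi (m + 1) ((norm (x - reflect k y))\<^sup>2) t
         + (norm (x - reflect k y))\<^sup>2 / 4 * heat_phi (m + 2) ((norm (x - reflect k y))\<^sup>2) t)
     + t * ray_source k (m + 1) (x - reflect k y) t)) (at t)"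
proof -
  have *: "((\<lambda>t. heat_phi m r t) has_real_derivative - m * heat_phi (m + 1) r t + r / 4 * heat_phi (m + 2) r t) (at t)" for r
    using DERIV_heat_phi[OF DERIV_const DERIV_ident t, of UNIV m r] by simp
  have z: "0 \<le> (x - reflect k y) $ k" using xy by simp
  show ?thesis
  proof (rule has_field_derivative_transform_within)
    show "((\<lambda>t. (4 * pi) powr (- m) * (heat_phi m ((norm (x - y))\<^sup>2) t
      - heat_phi m ((norm (x - reflect k y))\<^sup>2) t
      + t * ray_integral k 1 (m + 1) (x - reflect k y) t)) has_real_derivative (4 * pi) powr (- m) *
      ((- m * heat_phi (m + 1) ((norm (x - y))\<^sup>2) t
           + (norm (x - y))\<^sup>2 / 4 * heat_phi (m + 2) ((norm (x - y))\<^sup>2) t)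
       - (- m * heat_phi (m + 1) ((norm (x - reflect k y))\<^sup>2) t
           + (norm (x - reflect k y))\<^sup>2 / 4 * heat_phi (m + 2) ((norm (x - reflect k y))\<^sup>2) t)
       + t * ray_source k (m + 1) (x - reflect k y) t)) (at t)"
      by (intro DERIV_cmult DERIV_add DERIV_diff * ray_integral_deriv_time z t)
    show "t > 0" "t \<in> UNIV" using t by auto
    fix s assume "dist s t < t"
    then have "s > 0" by (auto simp: dist_real_def)
    then show "(4 * pi) powr (- m) * (heat_phi m ((norm (x - y))\<^sup>2) s
      - heat_phi m ((norm (x - reflect k y))\<^sup>2) s
      + s * ray_integral k 1 (m + 1) (x - reflect k y) s) = G_kernel k x y s"
      using xy by (simp add: G_kernel_eq m_def)
  qed
qed

text \<open>The reflected term is added with factor \<open>- 1\<close>, so that the rules for sums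
  and multiples of Laplacians apply to the whole expression.\<close>

lemma G_kernel_laplacian:
  fixes x y :: "real ^ 'n::finite"
  defines "m \<equiv> real CARD('n) / 2"
  assumes xy: "0 < x $ k" "0 \<le> y $ k" and t: "t > 0"
  shows "has_laplacian (\<lambda>z. G_kernel k z y t) ((4 * pi) powr (- m) *
    ((- m * heat_phi (m + 1) ((norm (x - y))\<^sup>2) t
         + (norm (x - y))\<^sup>2 / 4 * heat_phi (m + 2) ((norm (x - y))\<^sup>2) t)
     + - 1 * (- m * heat_phi (m + 1) ((norm (x - reflect k y))\<^sup>2) t
         + (norm (x - reflect k y))\<^sup>2 / 4 * heat_phi (m + 2) ((norm (x - reflect k y))\<^sup>2) t)
     + t * ray_source k (m + 1) (x - reflect k y) t)) x"
proof (rule has_laplacian_cong)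
  have "open {z :: real ^ 'n. 0 < z $ k}" by (rule open_halfspace_component_gt_cart)
  then have "\<forall>\<^sub>F z in nhds x. z \<in> {z. 0 < z $ k}"
    using xy by (intro eventually_nhds_in_open) auto
  then show "\<forall>\<^sub>F z in nhds x. G_kernel k z y t = (4 * pi) powr (- m) * (heat_phi m ((norm (z - y))\<^sup>2) t
      + - 1 * heat_phi m ((norm (z - reflect k y))\<^sup>2) t
      + t * ray_integral k 1 (m + 1) (z - reflect k y) t)"
    by eventually_elim (use xy t in \<open>simp add: G_kernel_eq m_def\<close>)
  have z: "0 < (x - reflect k y) $ k" using xy by simp
  show "has_laplacian (\<lambda>z. (4 * pi) powr (- m) * (heat_phi m ((norm (z - y))\<^sup>2) t
      + - 1 * heat_phi m ((norm (z - reflect k y))\<^sup>2) t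
      + t * ray_integral k 1 (m + 1) (z - reflect k y) t)) ((4 * pi) powr (- m) *
    ((- m * heat_phi (m + 1) ((norm (x - y))\<^sup>2) t
         + (norm (x - y))\<^sup>2 / 4 * heat_phi (m + 2) ((norm (x - y))\<^sup>2) t)
     + - 1 * (- m * heat_phi (m + 1) ((norm (x - reflect k y))\<^sup>2) t
         + (norm (x - reflect k y))\<^sup>2 / 4 * heat_phi (m + 2) ((norm (x - reflect k y))\<^sup>2) t)
     + t * ray_source k (m + 1) (x - reflect k y) t)) x"
    unfolding m_def
    by (intro has_laplacian_cmult has_laplacian_add
        has_laplacian_shift[where u = "\<lambda>z. heat_phi _ ((norm z)\<^sup>2) t"]
        has_laplacian_shift[where u = "\<lambda>z. ray_integral _ _ _ z t"]
        has_laplacian_heat_phi has_laplacian_ray_integral z t refl)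
qed

text \<open>On the boundary \<open>x - y\<close> and \<open>x - reflect k y\<close> have equal norms
  and opposite \<open>k\<close>-th components, so the Dirichlet part contributes
  \<open>y $ k\<close> times the profile of order \<open>m + 1\<close>. This is exactly the source
  term of \<open>ray_source_identity\<close>, and together they give \<open>t * ray_source\<close>,
  the time derivative of the ray part. The outer minus sign is that of the outward normal.\<close>

lemma G_kernel_normal_deriv:
  fixes x y :: "real ^ 'n::finite"
  defines "m \<equiv> real CARD('n) / 2"
  assumes xy: "x $ k = 0" "0 \<le> y $ k" and t: "t > 0"
  shows "has_normal_deriv k (\<lambda>z. G_kernel k z y t)
    (- ((4 * pi) powr (- m) * (t * ray_source k (m + 1) (x - reflect k y) t))) x"
proof -
  let ?z = "x - reflect k y"
  have z: "0 \<le> ?z $ k" using xy by simp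
  have r: "norm (x - y) = norm ?z"
    using norm_diff_reflect[of x k y] xy by (simp add: power2_eq_iff_nonneg)
  have p: "((\<lambda>s. heat_phi m ((norm (w + s *\<^sub>R axis k 1))\<^sup>2) t) has_real_derivative
       - (w $ k) / 2 * heat_phi (m + 1) ((norm w)\<^sup>2) t) (at 0 within {0..})" for w
    using has_partial_deriv_heat_phi[of k m t w, unfolded has_partial_deriv_def]
    by (rule DERIV_subset) auto
  have "((\<lambda>s. ray_integral k 1 (m + 1) (?z + s *\<^sub>R axis k 1) t) has_real_derivative
      ray_integral k 0 (m + 1) ?z t - ray_integral k 2 (m + 2) ?z t / 2) (at 0 within {0..})"
  proof -
    have "{0..} \<subseteq> {u. 0 \<le> (?z + u *\<^sub>R axis k 1) $ k}"
      using xy by auto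
    from DERIV_subset[OF ray_integral_deriv_axis[OF z t, of 1 "m + 1" k] this] show ?thesis
      by (simp add: numeral_2_eq_2 add.assoc)
  qed
  then have d: "((\<lambda>s. (4 * pi) powr (- m) * (heat_phi m ((norm ((x - y) + s *\<^sub>R axis k 1))\<^sup>2) t
      - heat_phi m ((norm (?z + s *\<^sub>R axis k 1))\<^sup>2) t
      + t * ray_integral k 1 (m + 1) (?z + s *\<^sub>R axis k 1) t)) has_real_derivative
     (4 * pi) powr (- m) * (- ((x - y) $ k) / 2 * heat_phi (m + 1) ((norm (x - y))\<^sup>2) t
      - - (?z $ k) / 2 * heat_phi (m + 1) ((norm ?z)\<^sup>2) t
      + t * (ray_integral k 0 (m + 1) ?z t - ray_integral k 2 (m + 2) ?z t / 2))) (at 0 within {0..})"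
    by (intro DERIV_cmult DERIV_add DERIV_diff p)
  have "(4 * pi) powr (- m) * (- ((x - y) $ k) / 2 * heat_phi (m + 1) ((norm (x - y))\<^sup>2) t
      - - (?z $ k) / 2 * heat_phi (m + 1) ((norm ?z)\<^sup>2) t
      + t * (ray_integral k 0 (m + 1) ?z t - ray_integral k 2 (m + 2) ?z t / 2))
    = (4 * pi) powr (- m) * (t * ray_source k (m + 1) ?z t)"
    unfolding ray_source_identity[OF z t] r using xy by (simp add: add.assoc)
  note d[unfolded this]
  then show ?thesis
    unfolding has_normal_deriv_def minus_minus
  proof (rule has_field_derivative_transform_within[where d = 1])
    fix s :: real assume s: "s \<in> {0..}"
    then have "0 \<le> (x + s *\<^sub>R axis k 1) $ k" using xy by simp
    from G_kernel_eq[OF this xy(2) t]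
    show "(4 * pi) powr (- m) * (heat_phi m ((norm ((x - y) + s *\<^sub>R axis k 1))\<^sup>2) t
      - heat_phi m ((norm (?z + s *\<^sub>R axis k 1))\<^sup>2) t
      + t * ray_integral k 1 (m + 1) (?z + s *\<^sub>R axis k 1) t) = G_kernel k (x + s *\<^sub>R axis k 1) y t"
      by (simp add: m_def algebra_simps)
  qed auto
qed

lemma G_kernel_commute:
  "G_kernel k x y t = G_kernel k y x t"
proof -
  have r: "norm (x - reflect k y + u *\<^sub>R axis k 1) = norm (y - reflect k x + u *\<^sub>R axis k 1)" for u
  proof -
    have "(norm (x - reflect k y + u *\<^sub>R axis k 1))\<^sup>2 = (norm (y - reflect k x + u *\<^sub>R axis k 1))\<^sup>2"
      unfolding norm_add_axis norm_diff_reflect by (simp add: norm_minus_commute add.commute mult.commute)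
    then show ?thesis by (simp add: power2_eq_iff_nonneg)
  qed
  have "dipole k (x - reflect k y + u *\<^sub>R axis k 1) s = dipole k (y - reflect k x + u *\<^sub>R axis k 1) s" for u s
    unfolding dipole_def r by (simp add: reflect_def add.commute)
  then have "H_kernel k x y t = H_kernel k y x t"
    unfolding H_kernel_eq_LINT by simp
  moreover have "gauss_kernel (x - y) t = gauss_kernel (y - x) t"
    by (simp add: gauss_kernel_def norm_minus_commute)
  moreover have "gauss_kernel (x - reflect k y) t = gauss_kernel (y - reflect k x) t"
    using r[of 0] by (simp add: gauss_kernel_def)
  ultimately show ?thesis by (simp add: G_kernel_def)
qed

section \<open>One-dimensional Gaussian integrals\<close>

text \<open>The heat kernel of the line, that is, the centred normal density of variance
  \<open>2 * s\<close>.\<close>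

definition gauss1 :: "real \<Rightarrow> real \<Rightarrow> real" where
  "gauss1 s a = exp (- (a\<^sup>2 / (4 * s))) / sqrt (4 * pi * s)"

lemma gauss1_nonneg [simp]: "s > 0 \<Longrightarrow> 0 \<le> gauss1 s a"
  by (simp add: gauss1_def)

lemma measurable_gauss1 [measurable (raw)]:
  assumes [measurable]: "f \<in> borel_measurable M" "g \<in> borel_measurable M"
  shows "(\<lambda>x. gauss1 (f x) (g x)) \<in> borel_measurable M"
  unfolding gauss1_def by measurable

lemma gauss1_eq_normal_density: "s > 0 \<Longrightarrow> gauss1 s (x - c) = normal_density c (sqrt (2 * s)) x"
  by (simp add: gauss1_def normal_density_def)

lemma nn_integral_gauss1: "s > 0 \<Longrightarrow> (\<integral>\<^sup>+x. ennreal (gauss1 s (x - c)) \<partial>lborel) = 1"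
  using nn_integral_eq_integral[OF integrable_normal_density[of "sqrt (2 * s)" c]]
  by (simp add: gauss1_eq_normal_density)

lemma nn_integral_gauss1_moment:
  assumes "s > 0"
  shows "(\<integral>\<^sup>+x. ennreal (gauss1 s (x - c) * (x - c)\<^sup>2) \<partial>lborel) = ennreal (2 * s)"
proof -
  have "has_bochner_integral lborel (\<lambda>x. gauss1 s (x - c) * (x - c)\<^sup>2) (2 * s)"
    using normal_moment_even[of "sqrt (2 * s)" c 1] assms
    by (simp add: gauss1_eq_normal_density fact_numeral)
  then show ?thesis
    using assms by (subst nn_integral_eq_integral) (auto simp: has_bochner_integral_iff)
qed

section \<open>The error function and Gaussian integrals on half-lines\<close>

definition erf :: "real \<Rightarrow> real" where
  "erf w = 2 / sqrt pi * (LBINT v=0..w. exp (- v\<^sup>2))"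

lemma erf_0 [simp]: "erf 0 = 0"
  by (simp add: erf_def zero_ereal_def[symmetric])

lemma DERIV_erf: "(erf has_real_derivative (2 / sqrt pi * exp (- w\<^sup>2))) (at w)"
proof -
  let ?a = "- \<bar>w\<bar> - 1" and ?b = "\<bar>w\<bar> + 1"
  have "((\<lambda>u. LBINT v=ereal 0..u. exp (- v\<^sup>2)) has_vector_derivative exp (- w\<^sup>2)) (at w within {?a..?b})"
    by (rule interval_integral_FTC2) (auto intro!: continuous_intros)
  moreover have "at w within {?a..?b} = at w"
    by (rule at_within_interior) auto
  ultimately have "((\<lambda>u. LBINT v=0..u. exp (- v\<^sup>2)) has_real_derivative exp (- w\<^sup>2)) (at w)"
    unfolding has_real_derivative_iff_has_vector_derivative zero_ereal_def by simp
  from DERIV_cmult[OF this, of "2 / sqrt pi"] show ?thesis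
    by (simp add: erf_def[abs_def])
qed

lemma isCont_erf: "isCont erf w"
  using DERIV_erf by (rule DERIV_isCont)

lemma erf_minus: "erf (- w) = - erf w"
proof -
  have "((\<lambda>w. erf w + erf (- w)) has_real_derivative 0) (at w)" for w
    by (auto intro!: derivative_eq_intros DERIV_chain'[OF _ DERIV_erf])
  then have "erf w + erf (- w) = erf 0 + erf (- 0)"
    by (intro DERIV_isconst_all allI)
  then show ?thesis by simp
qed

lemma erf_tendsto_1: "(erf \<longlongrightarrow> 1) at_top"
proof -
  have 1: "((\<lambda>w. LINT v|lborel. indicator {..w} v *\<^sub>R (indicator {0..} v *\<^sub>R exp (- v\<^sup>2))) \<longlongrightarrow>
      (LINT v|lborel. indicator {0..} v *\<^sub>R exp (- (v::real)\<^sup>2))) at_top"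
    using gaussian_moment_0 by (intro tendsto_integral_at_top) (auto simp: has_bochner_integral_iff)
  have 2: "(LINT v|lborel. indicator {0..} v *\<^sub>R exp (- (v::real)\<^sup>2)) = sqrt pi / 2"
    using gaussian_moment_0 by (rule has_bochner_integral_integral_eq)
  have 3: "\<forall>\<^sub>F w::real in at_top. (LINT v|lborel. indicator {..w} v *\<^sub>R (indicator {0..} v *\<^sub>R exp (- v\<^sup>2)))
      = (LBINT v=0..w. exp (- v\<^sup>2))"
    using eventually_ge_at_top[of "0::real"]
  proof eventually_elim
    case (elim w)
    then have "(LBINT v=ereal 0..w. exp (- v\<^sup>2)) = (LBINT v:{0..w}. exp (- v\<^sup>2))"
      by (rule interval_integral_Icc)
    also have "\<dots> = (LINT v|lborel. indicator {..w} v *\<^sub>R (indicator {0..} v *\<^sub>R exp (- v\<^sup>2)))"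
      unfolding set_lebesgue_integral_def by (intro Bochner_Integration.integral_cong) (auto simp: indicator_def)
    finally show ?case by (simp add: zero_ereal_def)
  qed
  have "((\<lambda>w::real. LBINT v=0..w. exp (- v\<^sup>2)) \<longlongrightarrow> sqrt pi / 2) at_top"
    using Lim_transform_eventually[OF 1[unfolded 2] 3] .
  from tendsto_mult_left[OF this, of "2 / sqrt pi"] show ?thesis
    by (simp add: erf_def[abs_def])
qed

lemma DERIV_erf_scaled:
  assumes "t > 0"
  shows "((\<lambda>a. erf ((a + c) / (2 * sqrt t)) / 2) has_real_derivative gauss1 t (a + c)) (at a)"
proof -
  have "((\<lambda>a. (a + c) / (2 * sqrt t)) has_real_derivative 1 / (2 * sqrt t)) (at a)"
    by (rule DERIV_cong[OF DERIV_cdivide[OF DERIV_add[OF DERIV_ident DERIV_const]]]) simp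
  from DERIV_cdivide[OF DERIV_chain'[OF this DERIV_erf], of 2] show ?thesis
    using assms by (simp add: gauss1_def power_divide real_sqrt_mult power_mult_distrib ac_simps)
qed

lemma filterlim_scaled_at_top:
  "t > 0 \<Longrightarrow> filterlim (\<lambda>a. (a + c) / (2 * sqrt t)) at_top at_top"
  by real_asymp

lemma nn_integral_gauss1_tail:
  assumes "t > 0"
  shows "(\<integral>\<^sup>+a. ennreal (gauss1 t (a + c)) * indicator {0<..} a \<partial>lborel) = ennreal ((1 - erf (c / (2 * sqrt t))) / 2)"
proof -
  have "((\<lambda>a. erf ((a + c) / (2 * sqrt t)) / 2) \<longlongrightarrow> 1 / 2) at_top"
    by (intro tendsto_divide filterlim_compose[OF erf_tendsto_1] filterlim_scaled_at_top assms tendsto_const) simp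
  then have "(\<integral>\<^sup>+a. ennreal (gauss1 t (a + c)) * indicator {0..} a \<partial>lborel) = ennreal (1 / 2 - erf ((0 + c) / (2 * sqrt t)) / 2)"
    using assms by (intro nn_integral_FTC_atLeast DERIV_erf_scaled) auto
  then have "(\<integral>\<^sup>+a. ennreal (gauss1 t (a + c)) * indicator {0..} a \<partial>lborel) = ennreal ((1 - erf (c / (2 * sqrt t))) / 2)"
    by (simp only: add_0_left diff_divide_distrib)
  moreover have "(\<integral>\<^sup>+a. ennreal (gauss1 t (a + c)) * indicator {0<..} a \<partial>lborel) = (\<integral>\<^sup>+a. ennreal (gauss1 t (a + c)) * indicator {0..} a \<partial>lborel)"
    by (rule nn_integral_cong_AE, rule AE_mp[OF AE_lborel_singleton[of 0]], rule AE_I2) (simp add: indicator_def)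
  ultimately show ?thesis by simp
qed

text \<open>The integrand is the derivative of \<open>- 2 * gauss1 s (a + c)\<close>. In the
  interior mass of \<open>H\<close> this evaluates the integral over the normal variable.\<close>

lemma nn_integral_gauss1_deriv:
  assumes "s > 0" "c \<ge> 0"
  shows "(\<integral>\<^sup>+a. ennreal ((a + c) / s * gauss1 s (a + c)) * indicator {0<..} a \<partial>lborel) = ennreal (2 * gauss1 s c)"
proof -
  have "((\<lambda>a. exp (- ((a + c)\<^sup>2 / (4 * s)))) has_real_derivative
      - ((a + c) / (2 * s)) * exp (- ((a + c)\<^sup>2 / (4 * s)))) (at a)" for a
    using assms by (auto intro!: derivative_eq_intros simp: field_simps)
  from DERIV_cmult[OF DERIV_cdivide[OF this], of "- 2" "sqrt (4 * pi * s)"]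
  have D: "((\<lambda>a. - 2 * gauss1 s (a + c)) has_real_derivative (a + c) / s * gauss1 s (a + c)) (at a)" for a
    by (simp add: gauss1_def)
  have "((\<lambda>u. exp (- u\<^sup>2)) \<longlongrightarrow> (0::real)) at_top"
    by real_asymp
  from tendsto_mult_right[OF filterlim_compose[OF this filterlim_scaled_at_top[OF \<open>s > 0\<close>, of c]], of "- 2 / sqrt (4 * pi * s)"]
  have L: "((\<lambda>a. - 2 * gauss1 s (a + c)) \<longlongrightarrow> 0) at_top"
    using assms by (simp add: gauss1_def power_divide power_mult_distrib mult.commute)
  have "(\<integral>\<^sup>+a. ennreal ((a + c) / s * gauss1 s (a + c)) * indicator {0..} a \<partial>lborel) = ennreal (0 - (- 2 * gauss1 s (0 + c)))"
    using assms by (intro nn_integral_FTC_atLeast D L) auto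
  moreover have "(\<integral>\<^sup>+a. ennreal ((a + c) / s * gauss1 s (a + c)) * indicator {0<..} a \<partial>lborel)
     = (\<integral>\<^sup>+a. ennreal ((a + c) / s * gauss1 s (a + c)) * indicator {0..} a \<partial>lborel)"
    by (rule nn_integral_cong_AE, rule AE_mp[OF AE_lborel_singleton[of 0]], rule AE_I2) (simp add: indicator_def)
  ultimately show ?thesis by simp
qed

text \<open>Meant for integrands in \<open>\<tau>\<close> that contain powers of
  \<open>1 / sqrt (t - \<tau>)\<close>: the antiderivative needs only one-sided limits at the ends,
  and nonnegativity makes the integral converge.\<close>

lemma nn_integral_FTC_open:
  fixes a b :: real
  assumes "a < b"
    and D: "\<And>x. a < x \<Longrightarrow> x < b \<Longrightarrow> (F has_real_derivative f x) (at x)"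
    and C: "\<And>x. a < x \<Longrightarrow> x < b \<Longrightarrow> isCont f x"
    and N: "\<And>x. a < x \<Longrightarrow> x < b \<Longrightarrow> 0 \<le> f x"
    and A: "(F \<longlongrightarrow> A) (at_right a)" and B: "(F \<longlongrightarrow> B) (at_left b)"
  shows "(\<integral>\<^sup>+x. ennreal (f x) * indicator {a<..<b} x \<partial>lborel) = ennreal (B - A)"
proof -
  have *: "ereal a < ereal b" "((F \<circ> real_of_ereal) \<longlongrightarrow> A) (at_right (ereal a))"
    "((F \<circ> real_of_ereal) \<longlongrightarrow> B) (at_left (ereal b))"
    using \<open>a < b\<close> A B by (simp_all add: ereal_tendsto_simps)
  have D': "(F has_real_derivative f x) (at x)" and C': "isCont f x" if "ereal a < ereal x" "ereal x < ereal b" for x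
    using D C that by simp_all
  have N': "AE x in lborel. ereal a < ereal x \<longrightarrow> ereal x < ereal b \<longrightarrow> 0 \<le> f x"
    using N by (intro AE_I2) simp
  have i: "set_integrable lborel {a<..<b} f"
    using interval_integral_FTC_nonneg(1)[OF *(1) D' C' N' *(2,3)] by (simp only: einterval_eq)
  have "(LBINT x=a..b. f x) = B - A"
    by (rule interval_integral_FTC_nonneg(2)[OF *(1) D' C' N' *(2,3)])
  then have v: "(LBINT x:{a<..<b}. f x) = B - A"
    using \<open>a < b\<close> by (simp add: interval_integral_Ioo)
  have "(\<integral>\<^sup>+x. ennreal (f x) * indicator {a<..<b} x \<partial>lborel) = (\<integral>\<^sup>+x. ennreal (indicator {a<..<b} x *\<^sub>R f x) \<partial>lborel)"
    by (intro nn_integral_cong) (auto simp: indicator_def)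
  also have "\<dots> = ennreal (B - A)"
    using i v N unfolding set_integrable_def set_lebesgue_integral_def
    by (subst nn_integral_eq_integral) (auto simp: indicator_def)
  finally show ?thesis .
qed

lemma DERIV_sqrt_diff:
  assumes "\<tau> < t"
  shows "((\<lambda>\<tau>. c * sqrt (t - \<tau>)) has_real_derivative - c / (2 * sqrt (t - \<tau>))) (at \<tau>)"
proof -
  have "((\<lambda>\<tau>. t - \<tau>) has_real_derivative 0 - 1) (at \<tau>)"
    by (rule DERIV_diff[OF DERIV_const DERIV_ident])
  moreover have "(sqrt has_real_derivative inverse (sqrt (t - \<tau>)) / 2) (at (t - \<tau>))"
    using assms by (intro DERIV_real_sqrt) simp
  ultimately have "((\<lambda>\<tau>. sqrt (t - \<tau>)) has_real_derivative inverse (sqrt (t - \<tau>)) / 2 * (0 - 1)) (at \<tau>)"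
    by (rule DERIV_chain'[where g = sqrt])
  from DERIV_cmult[OF this, of c] show ?thesis
    by (rule DERIV_cong) (simp add: inverse_eq_divide)
qed

text \<open>Differentiating \<open>(b + \<tau>) / (2 * sqrt (t - \<tau>))\<close> by the quotient
  rule produces two terms. After multiplication by the derivative of \<open>erf\<close>, the one
  from the numerator is the first integrand (interior mass) and the one from the denominator is the
  second (boundary mass). So it is their sum that has the antiderivative
  \<open>erf ((b + \<tau>) / (2 * sqrt (t - \<tau>)))\<close>.\<close>

lemma nn_integral_gauss1_time:
  assumes t: "t > 0" and b: "b \<ge> 0"
  shows "(\<integral>\<^sup>+\<tau>. ennreal (2 * gauss1 (t - \<tau>) (b + \<tau>)) * indicator {0<..<t} \<tau> \<partial>lborel)
    + (\<integral>\<^sup>+\<tau>. ennreal ((b + \<tau>) / (t - \<tau>) * gauss1 (t - \<tau>) (b + \<tau>)) * indicator {0<..<t} \<tau> \<partial>lborel)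
    = ennreal (1 - erf (b / (2 * sqrt t)))"
proof -
  let ?f = "\<lambda>\<tau>. 2 * gauss1 (t - \<tau>) (b + \<tau>) + (b + \<tau>) / (t - \<tau>) * gauss1 (t - \<tau>) (b + \<tau>)"
  let ?w = "\<lambda>\<tau>. (b + \<tau>) / (2 * sqrt (t - \<tau>))"
  have 1: "(\<integral>\<^sup>+\<tau>. ennreal (?f \<tau>) * indicator {0<..<t} \<tau> \<partial>lborel) = ennreal (1 - erf (b / (2 * sqrt t)))"
  proof (rule nn_integral_FTC_open[OF t, of "\<lambda>\<tau>. erf (?w \<tau>)"])
    fix \<tau> assume \<tau>: "0 < \<tau>" "\<tau> < t"
    define s where "s = sqrt (t - \<tau>)"
    have "0 < t - \<tau>" using \<tau> by linarith
    then have s: "s > 0" "t - \<tau> = s\<^sup>2"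
      unfolding s_def by (simp_all only: real_sqrt_gt_zero real_sqrt_pow2 less_imp_le)
    have "((\<lambda>\<tau>. 2 * sqrt (t - \<tau>)) has_real_derivative - 1 / s) (at \<tau>)"
      using DERIV_sqrt_diff[OF \<tau>(2), of 2] by (simp add: s_def)
    moreover have "((\<lambda>\<tau>. b + \<tau>) has_real_derivative 1) (at \<tau>)"
      by (rule DERIV_cong[OF DERIV_add[OF DERIV_const DERIV_ident]]) simp
    moreover have "2 * sqrt (t - \<tau>) \<noteq> 0"
      using \<tau> by simp
    ultimately have "(?w has_real_derivative (1 * (2 * sqrt (t - \<tau>)) - (b + \<tau>) * (- 1 / s)) / ((2 * sqrt (t - \<tau>)) * (2 * sqrt (t - \<tau>)))) (at \<tau>)"
      by (intro DERIV_divide)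
    then have "(?w has_real_derivative (1 * (2 * s) - (b + \<tau>) * (- 1 / s)) / ((2 * s) * (2 * s))) (at \<tau>)"
      unfolding s_def .
    note d = DERIV_chain'[OF this DERIV_erf]
    have g: "gauss1 (t - \<tau>) (b + \<tau>) = exp (- (?w \<tau>)\<^sup>2) / (2 * sqrt pi * s)"
      unfolding s_def using \<tau> by (simp add: gauss1_def real_sqrt_mult power_divide power_mult_distrib)
    have alg: "2 / p * e * ((1 * (2 * s) - c * (- 1 / s)) / ((2 * s) * (2 * s)))
      = 2 * (e / (2 * p * s)) + c / r * (e / (2 * p * s))" if "p > 0" "r = s\<^sup>2" for c e p r :: real
      using that s(1) by (simp add: field_simps power2_eq_square)
    show "((\<lambda>\<tau>. erf (?w \<tau>)) has_real_derivative ?f \<tau>) (at \<tau>)"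
      unfolding g by (rule DERIV_cong[OF d], rule alg) (use s in auto)
    show "isCont ?f \<tau>"
      unfolding gauss1_def using \<tau> by (auto intro!: continuous_intros)
    show "0 \<le> ?f \<tau>" using \<tau> b by (auto simp: gauss1_def intro!: add_nonneg_nonneg mult_nonneg_nonneg)
  next
    have "isCont (\<lambda>\<tau>. erf (?w \<tau>)) 0"
      using t by (intro isCont_o2[OF _ isCont_erf] continuous_intros) auto
    then show "((\<lambda>\<tau>. erf (?w \<tau>)) \<longlongrightarrow> erf (b / (2 * sqrt t))) (at_right 0)"
      by (auto simp: isCont_def intro: tendsto_within_subset)
    \<comment> \<open>The numerator tends to \<open>b + t\<close>, which is positive even for
      \<open>b = 0\<close>, and the denominator tends to 0 from above; hence the upper end
      contributes \<open>erf = 1\<close>.\<close>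
    have "filterlim ?w at_top (at_left t)"
    proof (rule LIM_at_top_divide)
      show "((\<lambda>\<tau>. b + \<tau>) \<longlongrightarrow> b + t) (at_left t)" by (intro tendsto_intros)
      show "b + t > 0" using t b by simp
      have "((\<lambda>\<tau>. 2 * sqrt (t - \<tau>)) \<longlongrightarrow> 2 * sqrt (t - t)) (at_left t)" by (intro tendsto_intros)
      then show "((\<lambda>\<tau>. 2 * sqrt (t - \<tau>)) \<longlongrightarrow> 0) (at_left t)" by simp
      show "\<forall>\<^sub>F \<tau> in at_left t. 0 < 2 * sqrt (t - \<tau>)"
        by (auto simp: eventually_at_filter)
    qed
    then show "((\<lambda>\<tau>. erf (?w \<tau>)) \<longlongrightarrow> 1) (at_left t)"
      by (rule filterlim_compose[OF erf_tendsto_1])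
  qed
  have "(\<integral>\<^sup>+\<tau>. ennreal (?f \<tau>) * indicator {0<..<t} \<tau> \<partial>lborel) =
    (\<integral>\<^sup>+\<tau>. ennreal (2 * gauss1 (t - \<tau>) (b + \<tau>)) * indicator {0<..<t} \<tau>
       + ennreal ((b + \<tau>) / (t - \<tau>) * gauss1 (t - \<tau>) (b + \<tau>)) * indicator {0<..<t} \<tau> \<partial>lborel)"
  proof (rule nn_integral_cong)
    fix \<tau>
    show "ennreal (?f \<tau>) * indicator {0<..<t} \<tau> = ennreal (2 * gauss1 (t - \<tau>) (b + \<tau>)) * indicator {0<..<t} \<tau>
       + ennreal ((b + \<tau>) / (t - \<tau>) * gauss1 (t - \<tau>) (b + \<tau>)) * indicator {0<..<t} \<tau>"
    proof (cases "\<tau> \<in> {0<..<t}")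
      case True
      then have "0 \<le> 2 * gauss1 (t - \<tau>) (b + \<tau>)" "0 \<le> (b + \<tau>) / (t - \<tau>) * gauss1 (t - \<tau>) (b + \<tau>)"
        using b by simp_all
      from ennreal_plus[OF this] True show ?thesis by (simp only: indicator_simps mult_1_right)
    qed simp
  qed
  also have "\<dots> = (\<integral>\<^sup>+\<tau>. ennreal (2 * gauss1 (t - \<tau>) (b + \<tau>)) * indicator {0<..<t} \<tau> \<partial>lborel)
    + (\<integral>\<^sup>+\<tau>. ennreal ((b + \<tau>) / (t - \<tau>) * gauss1 (t - \<tau>) (b + \<tau>)) * indicator {0<..<t} \<tau> \<partial>lborel)"
    by (rule nn_integral_add) measurable
  finally show ?thesis unfolding 1 by (rule sym)
qed

text \<open>Bounding the exponential by 1 leaves the integral of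
  \<open>1 / sqrt (pi * (t - \<tau>))\<close>, which is the stated bound.\<close>

lemma nn_integral_gauss1_time_le:
  assumes t: "t > 0"
  shows "(\<integral>\<^sup>+\<tau>. ennreal (2 * gauss1 (t - \<tau>) (b + \<tau>)) * indicator {0<..<t} \<tau> \<partial>lborel) \<le> ennreal (2 * sqrt t / sqrt pi)"
proof -
  have "(\<integral>\<^sup>+\<tau>. ennreal (2 * gauss1 (t - \<tau>) (b + \<tau>)) * indicator {0<..<t} \<tau> \<partial>lborel)
    \<le> (\<integral>\<^sup>+\<tau>. ennreal (1 / (sqrt pi * sqrt (t - \<tau>))) * indicator {0<..<t} \<tau> \<partial>lborel)"
  proof (rule nn_integral_mono)
    fix \<tau>
    have "2 * gauss1 (t - \<tau>) (b + \<tau>) \<le> 1 / (sqrt pi * sqrt (t - \<tau>))" if "\<tau> < t"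
    proof -
      have "gauss1 (t - \<tau>) (b + \<tau>) \<le> 1 / sqrt (4 * pi * (t - \<tau>))"
        unfolding gauss1_def using that by (intro divide_right_mono) auto
      then show ?thesis by (simp add: real_sqrt_mult)
    qed
    then show "ennreal (2 * gauss1 (t - \<tau>) (b + \<tau>)) * indicator {0<..<t} \<tau>
      \<le> ennreal (1 / (sqrt pi * sqrt (t - \<tau>))) * indicator {0<..<t} \<tau>"
      by (cases "\<tau> \<in> {0<..<t}") (simp_all add: ennreal_leI)
  qed
  also have "\<dots> = ennreal (0 - (- 2 * sqrt t / sqrt pi))"
  proof (rule nn_integral_FTC_open[OF t, of "\<lambda>\<tau>. - 2 * sqrt (t - \<tau>) / sqrt pi"])
    fix \<tau> assume \<tau>: "0 < \<tau>" "\<tau> < t"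
    show "((\<lambda>\<tau>. - 2 * sqrt (t - \<tau>) / sqrt pi) has_real_derivative 1 / (sqrt pi * sqrt (t - \<tau>))) (at \<tau>)"
      by (rule DERIV_cong[OF DERIV_cdivide[OF DERIV_sqrt_diff[OF \<tau>(2)]]]) (simp add: mult.commute)
    show "isCont (\<lambda>\<tau>. 1 / (sqrt pi * sqrt (t - \<tau>))) \<tau>"
      using \<tau> by (auto intro!: continuous_intros)
    show "0 \<le> 1 / (sqrt pi * sqrt (t - \<tau>))" using \<tau> by simp
  next
    have c: "isCont (\<lambda>\<tau>. - 2 * sqrt (t - \<tau>) / sqrt pi) \<tau>" for \<tau>
      by (auto intro!: continuous_intros)
    show "((\<lambda>\<tau>. - 2 * sqrt (t - \<tau>) / sqrt pi) \<longlongrightarrow> - 2 * sqrt t / sqrt pi) (at_right 0)"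
      using c[of 0] by (auto simp: isCont_def intro: tendsto_within_subset)
    show "((\<lambda>\<tau>. - 2 * sqrt (t - \<tau>) / sqrt pi) \<longlongrightarrow> 0) (at_left t)"
      using c[of t] by (auto simp: isCont_def intro: tendsto_within_subset)
  qed
  finally show ?thesis by simp
qed

section \<open>Integration over coordinate subspaces\<close>

text \<open>Covers both \<^term>\<open>surface_measure k\<close> (\<open>J = UNIV - {k}\<close>) and Lebesgue measure (\<open>J = UNIV\<close>).\<close>

definition coord_measure :: "'n::finite set \<Rightarrow> (real ^ 'n) measure" where
  "coord_measure J = distr (PiM J (\<lambda>_. lborel)) borel (\<lambda>f. \<chi> i. if i \<in> J then f i else 0)"

lemma measurable_vec_nth [measurable (raw)]:
  assumes [measurable]: "f \<in> borel_measurable M"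
  shows "(\<lambda>x. f x $ i :: real) \<in> borel_measurable M"
proof -
  have "(\<lambda>x. f x \<bullet> axis i 1) \<in> borel_measurable M" by measurable
  then show ?thesis by (simp add: inner_axis)
qed

lemma measurable_coord_embedding [measurable]:
  "(\<lambda>f. \<chi> i. if i \<in> J then f i else 0) \<in> measurable (PiM J (\<lambda>_. lborel :: real measure)) (borel :: (real ^ 'n::finite) measure)"
proof (subst borel_measurable_euclidean_space, rule ballI)
  fix b :: "real ^ 'n"
  assume "b \<in> Basis"
  then obtain i where b: "b = axis i 1"
    by (auto simp: Basis_vec_def)
  show "(\<lambda>f. (\<chi> j. if j \<in> J then f j else 0) \<bullet> b) \<in> borel_measurable (PiM J (\<lambda>_. lborel :: real measure))"
  proof (cases "i \<in> J")
    case True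
    then have "(\<lambda>f. f i) \<in> measurable (PiM J (\<lambda>_. lborel :: real measure)) lborel"
      by (intro measurable_component_singleton) auto
    with True show ?thesis by (simp add: b inner_axis)
  qed (simp add: b inner_axis)
qed

lemma sets_coord_measure [simp, measurable_cong]: "sets (coord_measure J) = sets borel"
  by (simp add: coord_measure_def)

lemma space_coord_measure [simp]: "space (coord_measure J) = UNIV"
  by (simp add: coord_measure_def)

lemma surface_measure_eq_coord: "surface_measure k = coord_measure (UNIV - {k})"
proof -
  have "(\<lambda>f. \<chi> i. if i = k then 0 else f i) = (\<lambda>f. \<chi> i. if i \<in> UNIV - {k} then f i else (0 :: real))"
    by (auto simp: fun_eq_iff vec_eq_iff)
  then show ?thesis
    unfolding surface_measure_def coord_measure_def by simp
qed

lemma product_sigma_finite_lborel: "product_sigma_finite (\<lambda>_. lborel :: real measure)"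
  by standard

text \<open>Lebesgue measure is determined by its values on boxes. With this, integrals over the
  half-space and over its boundary are treated by the same product formulas.\<close>

lemma lborel_eq_coord: "(lborel :: (real ^ 'n::finite) measure) = coord_measure UNIV"
proof (rule lborel_eqI)
  interpret product_sigma_finite "\<lambda>_. lborel :: real measure" by (rule product_sigma_finite_lborel)
  fix l u :: "real ^ 'n"
  assume le: "\<And>b. b \<in> Basis \<Longrightarrow> l \<bullet> b \<le> u \<bullet> b"
  have le': "l $ i \<le> u $ i" for i
    using le[of "axis i 1"] by (auto simp: inner_axis Basis_vec_def)
  have "(\<lambda>f. \<chi> i. if i \<in> UNIV then f i else 0) -` box l u \<inter> space (PiM UNIV (\<lambda>_. lborel :: real measure))
      = PiE UNIV (\<lambda>i. {l $ i<..<u $ i})"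
    by (auto simp: mem_box_cart space_PiM PiE_iff extensional_def)
  then have "emeasure (coord_measure UNIV) (box l u) = emeasure (PiM UNIV (\<lambda>_. lborel)) (PiE UNIV (\<lambda>i. {l $ i<..<u $ i}))"
    unfolding coord_measure_def using measurable_coord_embedding[of UNIV] by (subst emeasure_distr) auto
  also have "\<dots> = (\<Prod>i\<in>UNIV. ennreal (u $ i - l $ i))"
    by (subst emeasure_PiM) (auto simp: le')
  also have "\<dots> = ennreal (\<Prod>i\<in>UNIV. u $ i - l $ i)"
    by (intro prod_ennreal) (simp add: le')
  also have "(\<Prod>i\<in>UNIV. u $ i - l $ i) = (\<Prod>b\<in>Basis. (u - l) \<bullet> b)"
    unfolding Basis_vec_def
    by (simp add: prod.UNION_disjoint axis_eq_axis inner_axis)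
  finally show "emeasure (coord_measure UNIV) (box l u) = ennreal (\<Prod>b\<in>Basis. (u - l) \<bullet> b)" .
qed simp

lemma nn_integral_coord_measure:
  "F \<in> borel_measurable borel \<Longrightarrow> (\<integral>\<^sup>+x. F x \<partial>coord_measure J)
     = (\<integral>\<^sup>+f. F (\<chi> i. if i \<in> J then f i else 0) \<partial>PiM J (\<lambda>_. lborel))"
  unfolding coord_measure_def by (subst nn_integral_distr) auto

text \<open>For \<open>J = {}\<close> both sides are 1. In this way \<open>N = 1\<close>, where the
  surface measure is the unit mass at 0, passes through all later computations without a case
  distinction.\<close>

lemma nn_integral_coord_measure_prod:
  assumes [measurable]: "\<And>i. i \<in> J \<Longrightarrow> f i \<in> borel_measurable borel"
  shows "(\<integral>\<^sup>+x. (\<Prod>i\<in>J. f i (x $ i)) \<partial>coord_measure J) = (\<Prod>i\<in>J. \<integral>\<^sup>+a. f i a \<partial>lborel)"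
proof -
  interpret product_sigma_finite "\<lambda>_. lborel :: real measure" by (rule product_sigma_finite_lborel)
  have "(\<integral>\<^sup>+x. (\<Prod>i\<in>J. f i (x $ i)) \<partial>coord_measure J) = (\<integral>\<^sup>+g. (\<Prod>i\<in>J. f i (g i)) \<partial>PiM J (\<lambda>_. lborel))"
    by (subst nn_integral_coord_measure) (auto intro!: nn_integral_cong prod.cong)
  also have "\<dots> = (\<Prod>i\<in>J. \<integral>\<^sup>+a. f i a \<partial>lborel)"
    by (rule product_nn_integral_prod) auto
  finally show ?thesis .
qed

lemma AE_coord_measure: "AE x in coord_measure J. \<forall>i. i \<notin> J \<longrightarrow> x $ i = 0"
  unfolding coord_measure_def by (subst AE_distr_iff) auto

text \<open>Tonelli is applied on the product space, before the push-forward, where sigma-finiteness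
  is at hand.\<close>

lemma nn_integral_coord_measure_swap:
  assumes [measurable]: "case_prod F \<in> borel_measurable (borel \<Otimes>\<^sub>M borel)"
  shows "(\<integral>\<^sup>+x. (\<integral>\<^sup>+\<tau>. F \<tau> x \<partial>lborel) \<partial>coord_measure J) = (\<integral>\<^sup>+\<tau>. (\<integral>\<^sup>+x. F \<tau> x \<partial>coord_measure J) \<partial>(lborel :: real measure))"
proof -
  interpret product_sigma_finite "\<lambda>_. lborel :: real measure" by (rule product_sigma_finite_lborel)
  interpret J: sigma_finite_measure "PiM J (\<lambda>_. lborel :: real measure)" by (rule sigma_finite) simp
  interpret pair_sigma_finite "lborel :: real measure" "PiM J (\<lambda>_. lborel :: real measure)" by standard
  let ?e = "\<lambda>f. \<chi> i. if i \<in> J then f i else (0 :: real)"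
  have "(\<integral>\<^sup>+x. (\<integral>\<^sup>+\<tau>. F \<tau> x \<partial>lborel) \<partial>coord_measure J) = (\<integral>\<^sup>+f. (\<integral>\<^sup>+\<tau>. F \<tau> (?e f) \<partial>lborel) \<partial>PiM J (\<lambda>_. lborel))"
    by (rule nn_integral_coord_measure) measurable
  also have "\<dots> = (\<integral>\<^sup>+\<tau>. (\<integral>\<^sup>+f. F \<tau> (?e f) \<partial>PiM J (\<lambda>_. lborel)) \<partial>lborel)"
    by (rule Fubini') measurable
  also have "\<dots> = (\<integral>\<^sup>+\<tau>. (\<integral>\<^sup>+x. F \<tau> x \<partial>coord_measure J) \<partial>(lborel :: real measure))"
    by (intro nn_integral_cong nn_integral_coord_measure[symmetric]) measurable
  finally show ?thesis .
qed

section \<open>Masses and second moments of products of Gaussians\<close>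

lemma nn_integral_coord_gauss:
  fixes c :: "real ^ 'n::finite"
  assumes "s > 0"
  shows "(\<integral>\<^sup>+x. ennreal (\<Prod>i\<in>J. gauss1 s (x $ i - c $ i)) \<partial>coord_measure J) = 1"
proof -
  have "(\<integral>\<^sup>+x. ennreal (\<Prod>i\<in>J. gauss1 s (x $ i - c $ i)) \<partial>coord_measure J)
    = (\<integral>\<^sup>+x. (\<Prod>i\<in>J. ennreal (gauss1 s (x $ i - c $ i))) \<partial>coord_measure J)"
    using assms by (simp add: prod_ennreal)
  also have "\<dots> = 1"
    using assms by (subst nn_integral_coord_measure_prod) (simp_all add: nn_integral_gauss1)
  finally show ?thesis .
qed

lemma nn_integral_coord_gauss_moment:
  fixes c :: "real ^ 'n::finite"
  assumes s: "s > 0"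
  shows "(\<integral>\<^sup>+x. ennreal ((\<Prod>i\<in>J. gauss1 s (x $ i - c $ i)) * (\<Sum>j\<in>J. (x $ j - c $ j)\<^sup>2)) \<partial>coord_measure J)
    = ennreal (real (card J) * (2 * s))"
proof -
  \<comment> \<open>In the \<open>j\<close>-th product the square is placed in the factor with index
    \<open>j\<close>; the second moment is then a sum of pure products, each with one factor of
    integral \<open>2 * s\<close> and all others of integral 1.\<close>
  let ?f = "\<lambda>j i a. ennreal (gauss1 s (a - c $ i) * (if i = j then (a - c $ i)\<^sup>2 else 1))"
  have 1: "ennreal ((\<Prod>i\<in>J. gauss1 s (x $ i - c $ i)) * (\<Sum>j\<in>J. (x $ j - c $ j)\<^sup>2)) = (\<Sum>j\<in>J. \<Prod>i\<in>J. ?f j i (x $ i))" for x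
  proof -
    have "(\<Prod>i\<in>J. gauss1 s (x $ i - c $ i)) * (\<Sum>j\<in>J. (x $ j - c $ j)\<^sup>2)
      = (\<Sum>j\<in>J. \<Prod>i\<in>J. gauss1 s (x $ i - c $ i) * (if i = j then (x $ i - c $ i)\<^sup>2 else 1))"
      unfolding sum_distrib_left prod.distrib
      by (intro sum.cong refl arg_cong2[where f = "(*)"]) (simp add: prod.delta)
    moreover have "(\<Prod>i\<in>J. ?f j i (x $ i)) = ennreal (\<Prod>i\<in>J. gauss1 s (x $ i - c $ i) * (if i = j then (x $ i - c $ i)\<^sup>2 else 1))" for j
      using s by (intro prod_ennreal) simp
    ultimately show ?thesis
      using s by (simp add: sum_ennreal prod_nonneg)
  qed
  have "(\<Prod>i\<in>J. \<integral>\<^sup>+a. ?f j i a \<partial>lborel) = ennreal (2 * s)" if "j \<in> J" for j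
  proof -
    have "(\<Prod>i\<in>J. \<integral>\<^sup>+a. ?f j i a \<partial>lborel) = (\<Prod>i\<in>J. if i = j then ennreal (2 * s) else 1)"
      using s by (intro prod.cong refl) (simp add: nn_integral_gauss1 nn_integral_gauss1_moment)
    also have "\<dots> = ennreal (2 * s)"
      using that by (simp add: prod.delta)
    finally show ?thesis .
  qed
  note 2 = this
  have "(\<integral>\<^sup>+x. (\<Sum>j\<in>J. \<Prod>i\<in>J. ?f j i (x $ i)) \<partial>coord_measure J) = (\<Sum>j\<in>J. \<integral>\<^sup>+x. (\<Prod>i\<in>J. ?f j i (x $ i)) \<partial>coord_measure J)"
    by (rule nn_integral_sum) measurable
  also have "\<dots> = (\<Sum>j\<in>J. ennreal (2 * s))"
  proof (rule sum.cong[OF refl])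
    fix j assume "j \<in> J"
    have "(\<integral>\<^sup>+x. (\<Prod>i\<in>J. ?f j i (x $ i)) \<partial>coord_measure J) = (\<Prod>i\<in>J. \<integral>\<^sup>+a. ?f j i a \<partial>lborel)"
      by (rule nn_integral_coord_measure_prod) measurable
    with 2[OF \<open>j \<in> J\<close>] show "(\<integral>\<^sup>+x. (\<Prod>i\<in>J. ?f j i (x $ i)) \<partial>coord_measure J) = ennreal (2 * s)"
      by (rule trans[rotated])
  qed
  also have "\<dots> = ennreal (real (card J) * (2 * s))"
    using s by (simp add: sum_ennreal ennreal_of_nat_eq_real_of_nat ennreal_mult)
  finally show ?thesis unfolding 1 .
qed

lemma nn_integral_lborel_split:
  fixes c :: "real ^ 'n::finite" and \<psi> :: "real \<Rightarrow> ennreal"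
  assumes "s > 0" and [measurable]: "\<psi> \<in> borel_measurable borel"
  shows "(\<integral>\<^sup>+x. \<psi> (x $ k) * ennreal (\<Prod>i\<in>UNIV - {k}. gauss1 s (x $ i - c $ i)) \<partial>lborel) = (\<integral>\<^sup>+a. \<psi> a \<partial>lborel)"
proof -
  let ?f = "\<lambda>i a. if i = k then \<psi> a else ennreal (gauss1 s (a - c $ i))"
  have U: "(\<Prod>i\<in>UNIV. g i) = g k * (\<Prod>i\<in>UNIV - {k}. g i)" for g :: "'n \<Rightarrow> ennreal"
    by (simp add: prod.remove)
  have "\<psi> (x $ k) * ennreal (\<Prod>i\<in>UNIV - {k}. gauss1 s (x $ i - c $ i)) = (\<Prod>i\<in>UNIV. ?f i (x $ i))" for x :: "real ^ 'n"
    unfolding U using assms(1) by (simp add: prod_ennreal[symmetric])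
  then have "(\<integral>\<^sup>+x. \<psi> (x $ k) * ennreal (\<Prod>i\<in>UNIV - {k}. gauss1 s (x $ i - c $ i)) \<partial>lborel)
    = (\<integral>\<^sup>+x. (\<Prod>i\<in>UNIV. ?f i (x $ i)) \<partial>coord_measure UNIV)"
    by (simp add: lborel_eq_coord)
  also have "\<dots> = (\<Prod>i\<in>UNIV. \<integral>\<^sup>+a. ?f i a \<partial>lborel)"
    by (rule nn_integral_coord_measure_prod) auto
  also have "\<dots> = (\<integral>\<^sup>+a. \<psi> a \<partial>lborel)"
    unfolding U using assms(1) by (simp add: nn_integral_gauss1)
  finally show ?thesis .
qed

lemma gauss_kernel_eq_prod:
  fixes w :: "real ^ 'n::finite"
  assumes "s > 0"
  shows "gauss_kernel w s = (\<Prod>i\<in>UNIV. gauss1 s (w $ i))"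
proof -
  have "(\<Prod>i\<in>UNIV. exp (- ((w $ i)\<^sup>2 / (4 * s)))) = exp (- ((norm w)\<^sup>2 / (4 * s)))"
    unfolding norm_sq_eq_sum by (simp add: exp_sum[symmetric] sum_negf sum_divide_distrib)
  moreover have "sqrt (4 * pi * s) ^ CARD('n) = (4 * pi * s) powr (real CARD('n) / 2)"
    using assms by (simp add: powr_half_sqrt[symmetric] powr_powr powr_realpow[symmetric])
  ultimately show ?thesis
    using assms by (simp add: gauss_kernel_def gauss1_def prod_dividef powr_minus field_simps)
qed

lemma gauss_kernel_split:
  fixes w :: "real ^ 'n::finite"
  assumes "s > 0"
  shows "gauss_kernel w s = gauss1 s (w $ k) * (\<Prod>i\<in>UNIV - {k}. gauss1 s (w $ i))"
  unfolding gauss_kernel_eq_prod[OF assms] by (simp add: prod.remove)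

section \<open>Masses and moments of \<open>H\<close>\<close>

lemma measurable_gauss_kernel [measurable (raw)]:
  assumes [measurable]: "f \<in> borel_measurable M" "g \<in> borel_measurable M"
  shows "(\<lambda>x. gauss_kernel (f x) (g x)) \<in> borel_measurable M"
  unfolding gauss_kernel_def by measurable

lemma measurable_dipole [measurable (raw)]:
  assumes [measurable]: "f \<in> borel_measurable M" "g \<in> borel_measurable M"
  shows "(\<lambda>x. dipole k (f x) (g x)) \<in> borel_measurable M"
  unfolding dipole_def by measurable

lemma measurable_H_kernel [measurable]: "(\<lambda>x. H_kernel k x y t) \<in> borel_measurable borel"
  unfolding H_kernel_eq_LINT set_lebesgue_integral_def by measurable

lemma gauss_kernel_nonneg: "0 \<le> gauss_kernel w s"
  by (simp add: gauss_kernel_def)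

lemma dipole_nonneg: "0 \<le> w $ k \<Longrightarrow> 0 \<le> dipole k w s"
  by (simp add: dipole_def)

lemma H_kernel_nonneg:
  assumes "0 \<le> x $ k" "0 \<le> y $ k"
  shows "0 \<le> H_kernel k x y t"
  unfolding H_kernel_eq_LINT set_lebesgue_integral_def
  using assms by (intro integral_nonneg_AE AE_I2) (auto simp: indicator_def intro!: dipole_nonneg)

lemma H_kernel_nn:
  assumes xy: "0 \<le> x $ k" "0 \<le> y $ k" and t: "t > 0"
  shows "ennreal (H_kernel k x y t)
    = (\<integral>\<^sup>+\<tau>. ennreal (dipole k (x - reflect k y + \<tau> *\<^sub>R axis k 1) (t - \<tau>)) * indicator {0<..<t} \<tau> \<partial>lborel)"
proof -
  let ?d = "\<lambda>\<tau>. dipole k (x - reflect k y + \<tau> *\<^sub>R axis k 1) (t - \<tau>)"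
  have "set_integrable lborel {0<..<t} ?d"
    using xy t by (intro set_integrable_dipole_ray) simp_all
  then have "(\<integral>\<^sup>+\<tau>. ennreal (indicator {0<..<t} \<tau> *\<^sub>R ?d \<tau>) \<partial>lborel) = ennreal (H_kernel k x y t)"
    unfolding H_kernel_eq_LINT set_lebesgue_integral_def set_integrable_def using xy
    by (intro nn_integral_eq_integral AE_I2) (auto simp: indicator_def intro!: dipole_nonneg)
  moreover have "(\<integral>\<^sup>+\<tau>. ennreal (indicator {0<..<t} \<tau> *\<^sub>R ?d \<tau>) \<partial>lborel)
      = (\<integral>\<^sup>+\<tau>. ennreal (?d \<tau>) * indicator {0<..<t} \<tau> \<partial>lborel)"
    by (intro nn_integral_cong) (simp add: indicator_def)
  ultimately show ?thesis by simp
qed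

lemma dipole_split:
  fixes x y :: "real ^ 'n::finite"
  assumes "\<tau> < t"
  shows "dipole k (x - reflect k y + \<tau> *\<^sub>R axis k 1) (t - \<tau>) =
    (x $ k + (y $ k + \<tau>)) / (t - \<tau>) * gauss1 (t - \<tau>) (x $ k + (y $ k + \<tau>))
      * (\<Prod>i\<in>UNIV - {k}. gauss1 (t - \<tau>) (x $ i - y $ i))"
proof -
  have s: "0 < t - \<tau>" using assms by simp
  have "(\<Prod>i\<in>UNIV - {k}. gauss1 (t - \<tau>) ((x - reflect k y + \<tau> *\<^sub>R axis k 1) $ i)) =
    (\<Prod>i\<in>UNIV - {k}. gauss1 (t - \<tau>) (x $ i - y $ i))"
    by (intro prod.cong refl) (auto simp: reflect_def axis_def)
  then show ?thesis
    unfolding dipole_eq[OF s] gauss_kernel_split[OF s, of _ k] by (simp add: add.assoc)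
qed

text \<open>The weight \<open>W\<close> will be the indicator of the half-space, the constant 1, or
  \<open>|x - y|^2\<close> on the boundary. The formula for \<open>H\<close> as a nonnegative
  integral is available for \<open>0 \<le> x $ k\<close>, hence the condition that \<open>W\<close>
  vanishes almost everywhere else.\<close>

lemma nn_integral_H_swap:
  fixes y :: "real ^ 'n::finite"
  assumes [measurable]: "W \<in> borel_measurable borel"
    and y: "0 \<le> y $ k" and t: "t > 0" and W: "AE x in coord_measure J. 0 \<le> x $ k \<or> W x = 0"
  shows "(\<integral>\<^sup>+x. ennreal (H_kernel k x y t) * W x \<partial>coord_measure J) =
    (\<integral>\<^sup>+\<tau>. (\<integral>\<^sup>+x. ennreal (dipole k (x - reflect k y + \<tau> *\<^sub>R axis k 1) (t - \<tau>)) * W x \<partial>coord_measure J)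
       * indicator {0<..<t} \<tau> \<partial>lborel)"
proof -
  let ?D = "\<lambda>\<tau> x. ennreal (dipole k (x - reflect k y + \<tau> *\<^sub>R axis k 1) (t - \<tau>))"
  have "(\<integral>\<^sup>+x. ennreal (H_kernel k x y t) * W x \<partial>coord_measure J)
    = (\<integral>\<^sup>+x. (\<integral>\<^sup>+\<tau>. ?D \<tau> x * W x * indicator {0<..<t} \<tau> \<partial>lborel) \<partial>coord_measure J)"
  proof (rule nn_integral_cong_AE)
    show "AE x in coord_measure J. ennreal (H_kernel k x y t) * W x = (\<integral>\<^sup>+\<tau>. ?D \<tau> x * W x * indicator {0<..<t} \<tau> \<partial>lborel)"
      using W
    proof eventually_elim
      case (elim x)
      show ?case
      proof (cases "W x = 0")
        case False
        with elim have "0 \<le> x $ k" by simp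
        have "(\<integral>\<^sup>+\<tau>. ?D \<tau> x * indicator {0<..<t} \<tau> \<partial>lborel) * W x = (\<integral>\<^sup>+\<tau>. ?D \<tau> x * indicator {0<..<t} \<tau> * W x \<partial>lborel)"
          by (rule nn_integral_multc[symmetric]) measurable
        then show ?thesis
          unfolding H_kernel_nn[OF \<open>0 \<le> x $ k\<close> y t] by (simp only: mult_ac)
      qed simp
    qed
  qed
  also have "\<dots> = (\<integral>\<^sup>+\<tau>. (\<integral>\<^sup>+x. ?D \<tau> x * W x * indicator {0<..<t} \<tau> \<partial>coord_measure J) \<partial>lborel)"
    by (rule nn_integral_coord_measure_swap) measurable
  also have "\<dots> = (\<integral>\<^sup>+\<tau>. (\<integral>\<^sup>+x. ?D \<tau> x * W x \<partial>coord_measure J) * indicator {0<..<t} \<tau> \<partial>lborel)"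
    by (intro nn_integral_cong nn_integral_multc) measurable
  finally show ?thesis .
qed

lemma measurable_half_space [measurable]: "half_space k \<in> sets borel"
  using open_half_space by (rule borel_open)

lemma nn_integral_H_interior:
  fixes y :: "real ^ 'n::finite"
  assumes y: "0 \<le> y $ k" and t: "t > 0"
  shows "(\<integral>\<^sup>+x. ennreal (H_kernel k x y t) * indicator (half_space k) x \<partial>lborel) =
    (\<integral>\<^sup>+\<tau>. ennreal (2 * gauss1 (t - \<tau>) (y $ k + \<tau>)) * indicator {0<..<t} \<tau> \<partial>lborel)"
proof -
  have "(\<integral>\<^sup>+x. ennreal (H_kernel k x y t) * indicator (half_space k) x \<partial>lborel) =
    (\<integral>\<^sup>+\<tau>. (\<integral>\<^sup>+x. ennreal (dipole k (x - reflect k y + \<tau> *\<^sub>R axis k 1) (t - \<tau>)) * indicator (half_space k) x \<partial>lborel)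
       * indicator {0<..<t} \<tau> \<partial>lborel)"
    unfolding lborel_eq_coord[where 'n = 'n] using y t
    by (intro nn_integral_H_swap AE_I2) (auto simp: half_space_def indicator_def)
  also have "\<dots> = (\<integral>\<^sup>+\<tau>. ennreal (2 * gauss1 (t - \<tau>) (y $ k + \<tau>)) * indicator {0<..<t} \<tau> \<partial>lborel)"
  proof (rule nn_integral_cong)
    fix \<tau>
    have "(\<integral>\<^sup>+x. ennreal (dipole k (x - reflect k y + \<tau> *\<^sub>R axis k 1) (t - \<tau>)) * indicator (half_space k) x \<partial>lborel)
       = ennreal (2 * gauss1 (t - \<tau>) (y $ k + \<tau>))" if \<tau>: "0 < \<tau>" "\<tau> < t"
    proof -
      let ?s = "t - \<tau>" and ?c = "y $ k + \<tau>"
      have s: "?s > 0" and c: "?c \<ge> 0" using \<tau> y by simp_all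
      let ?\<psi> = "\<lambda>a. ennreal ((a + ?c) / ?s * gauss1 ?s (a + ?c)) * indicator {0<..} a"
      have "ennreal (dipole k (x - reflect k y + \<tau> *\<^sub>R axis k 1) (t - \<tau>)) * indicator (half_space k) x
        = ?\<psi> (x $ k) * ennreal (\<Prod>i\<in>UNIV - {k}. gauss1 ?s (x $ i - y $ i))" for x
      proof (cases "x \<in> half_space k")
        case True
        then have "0 \<le> (x $ k + ?c) / ?s * gauss1 ?s (x $ k + ?c)"
          using s c by (simp add: half_space_def)
        then show ?thesis
          using True s unfolding dipole_split[OF \<tau>(2)]
          by (subst ennreal_mult) (auto simp: half_space_def intro!: prod_nonneg)
      qed (simp add: half_space_def)
      then show ?thesis
        unfolding nn_integral_gauss1_deriv[OF s c, symmetric]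
        by (simp only:) (rule nn_integral_lborel_split[OF s], measurable)
    qed
    then show "(\<integral>\<^sup>+x. ennreal (dipole k (x - reflect k y + \<tau> *\<^sub>R axis k 1) (t - \<tau>)) * indicator (half_space k) x \<partial>lborel)
       * indicator {0<..<t} \<tau> = ennreal (2 * gauss1 (t - \<tau>) (y $ k + \<tau>)) * indicator {0<..<t} \<tau>"
      by (cases "\<tau> \<in> {0<..<t}") simp_all
  qed
  finally show ?thesis .
qed

lemma AE_surface_measure: "AE x in surface_measure k. x $ k = 0"
  unfolding surface_measure_eq_coord using AE_coord_measure by (rule AE_mp) simp

text \<open>On the boundary the normal factor of the dipole does not depend on \<open>x\<close> and
  leaves the integral; only the tangential Gaussian is averaged against \<open>W\<close>, with value
  \<open>M s\<close>. It serves both the mass and the second moment.\<close>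

lemma nn_integral_H_boundary_weighted:
  fixes y :: "real ^ 'n::finite"
  assumes y: "0 \<le> y $ k" and t: "t > 0" and W [measurable]: "W \<in> borel_measurable borel"
    and M: "\<And>s. s > 0 \<Longrightarrow> (\<integral>\<^sup>+x. ennreal (\<Prod>i\<in>UNIV - {k}. gauss1 s (x $ i - y $ i)) * W x \<partial>surface_measure k) = ennreal (M s)"
  shows "(\<integral>\<^sup>+x. ennreal (H_kernel k x y t) * W x \<partial>surface_measure k) =
    (\<integral>\<^sup>+\<tau>. ennreal ((y $ k + \<tau>) / (t - \<tau>) * gauss1 (t - \<tau>) (y $ k + \<tau>)) * ennreal (M (t - \<tau>)) * indicator {0<..<t} \<tau> \<partial>lborel)"
proof -
  have [measurable_cong]: "sets (surface_measure k) = sets borel"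
    by (simp add: surface_measure_eq_coord)
  have "AE x in surface_measure k. 0 \<le> x $ k \<or> W x = 0"
    using AE_surface_measure by (rule AE_mp) simp
  then have "(\<integral>\<^sup>+x. ennreal (H_kernel k x y t) * W x \<partial>surface_measure k) =
    (\<integral>\<^sup>+\<tau>. (\<integral>\<^sup>+x. ennreal (dipole k (x - reflect k y + \<tau> *\<^sub>R axis k 1) (t - \<tau>)) * W x \<partial>surface_measure k)
       * indicator {0<..<t} \<tau> \<partial>lborel)"
    unfolding surface_measure_eq_coord by (intro nn_integral_H_swap y t W)
  also have "\<dots> = (\<integral>\<^sup>+\<tau>. ennreal ((y $ k + \<tau>) / (t - \<tau>) * gauss1 (t - \<tau>) (y $ k + \<tau>)) * ennreal (M (t - \<tau>)) * indicator {0<..<t} \<tau> \<partial>lborel)"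
  proof (rule nn_integral_cong)
    fix \<tau>
    let ?s = "t - \<tau>" and ?c = "y $ k + \<tau>"
    have "(\<integral>\<^sup>+x. ennreal (dipole k (x - reflect k y + \<tau> *\<^sub>R axis k 1) ?s) * W x \<partial>surface_measure k)
       = ennreal (?c / ?s * gauss1 ?s ?c) * ennreal (M ?s)" if \<tau>: "0 < \<tau>" "\<tau> < t"
    proof -
      have s: "?s > 0" and c: "?c \<ge> 0" using \<tau> y by simp_all
      have "(\<integral>\<^sup>+x. ennreal (dipole k (x - reflect k y + \<tau> *\<^sub>R axis k 1) ?s) * W x \<partial>surface_measure k)
        = (\<integral>\<^sup>+x. ennreal (?c / ?s * gauss1 ?s ?c) * (ennreal (\<Prod>i\<in>UNIV - {k}. gauss1 ?s (x $ i - y $ i)) * W x) \<partial>surface_measure k)"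
      proof (rule nn_integral_cong_AE)
        have nn: "0 \<le> ?c / ?s * gauss1 ?s ?c" using s c by simp
        show "AE x in surface_measure k. ennreal (dipole k (x - reflect k y + \<tau> *\<^sub>R axis k 1) ?s) * W x
          = ennreal (?c / ?s * gauss1 ?s ?c) * (ennreal (\<Prod>i\<in>UNIV - {k}. gauss1 ?s (x $ i - y $ i)) * W x)"
          using AE_surface_measure[of k]
        proof eventually_elim
          case (elim x)
          show ?case
            unfolding dipole_split[OF \<tau>(2)] elim add_0_left using nn s
            by (subst ennreal_mult) (auto simp: mult.assoc intro!: prod_nonneg)
        qed
      qed
      also have "\<dots> = ennreal (?c / ?s * gauss1 ?s ?c) * ennreal (M ?s)"
        unfolding M[OF s, symmetric] by (rule nn_integral_cmult) measurable
      finally show ?thesis .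
    qed
    then show "(\<integral>\<^sup>+x. ennreal (dipole k (x - reflect k y + \<tau> *\<^sub>R axis k 1) ?s) * W x \<partial>surface_measure k) * indicator {0<..<t} \<tau>
      = ennreal (?c / ?s * gauss1 ?s ?c) * ennreal (M ?s) * indicator {0<..<t} \<tau>"
      by (cases "\<tau> \<in> {0<..<t}") simp_all
  qed
  finally show ?thesis .
qed

lemma nn_integral_H_boundary:
  fixes y :: "real ^ 'n::finite"
  assumes y: "0 \<le> y $ k" and t: "t > 0"
  shows "(\<integral>\<^sup>+x. ennreal (H_kernel k x y t) \<partial>surface_measure k) =
    (\<integral>\<^sup>+\<tau>. ennreal ((y $ k + \<tau>) / (t - \<tau>) * gauss1 (t - \<tau>) (y $ k + \<tau>)) * indicator {0<..<t} \<tau> \<partial>lborel)"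
  using nn_integral_H_boundary_weighted[OF y t, of "\<lambda>_. 1" "\<lambda>_. 1"]
  by (simp add: surface_measure_eq_coord nn_integral_coord_gauss)

lemma H_kernel_total_mass:
  fixes y :: "real ^ 'n::finite"
  assumes y: "0 \<le> y $ k" and t: "t > 0"
  shows "(\<integral>\<^sup>+x. ennreal (H_kernel k x y t) * indicator (half_space k) x \<partial>lborel)
    + (\<integral>\<^sup>+x. ennreal (H_kernel k x y t) \<partial>surface_measure k) = ennreal (1 - erf (y $ k / (2 * sqrt t)))"
  unfolding nn_integral_H_interior[OF assms] nn_integral_H_boundary[OF assms]
  by (rule nn_integral_gauss1_time[OF t y])

lemma nn_integral_H_interior_le:
  fixes y :: "real ^ 'n::finite"
  assumes y: "0 \<le> y $ k" and t: "t > 0"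
  shows "(\<integral>\<^sup>+x. ennreal (H_kernel k x y t) * indicator (half_space k) x \<partial>lborel) \<le> ennreal (2 * sqrt t / sqrt pi)"
  unfolding nn_integral_H_interior[OF assms] by (rule nn_integral_gauss1_time_le[OF t])

text \<open>For \<open>y\<close> on the boundary \<open>|x - y|^2\<close> is purely tangential, so
  the Gaussian at time \<open>t - \<tau>\<close> has second moment
  \<open>(N - 1) * 2 * (t - \<tau>)\<close>, at most \<open>N * 2 * t\<close>. This constant leaves
  the integral over \<open>\<tau>\<close>, and what is left is the boundary mass of
  \<open>H\<close>, which is at most 1.\<close>

lemma nn_integral_H_boundary_moment:
  fixes y :: "real ^ 'n::finite"
  assumes y: "y $ k = 0" and t: "t > 0"
  shows "(\<integral>\<^sup>+x. ennreal (H_kernel k x y t * (dist x y)\<^sup>2) \<partial>surface_measure k) \<le> ennreal (real CARD('n) * (2 * t))"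
proof -
  have y': "0 \<le> y $ k" using y by simp
  have [measurable_cong]: "sets (surface_measure k) = sets borel"
    by (simp add: surface_measure_eq_coord)
  let ?N = "real (card (UNIV - {k}))"
  have d: "AE x in surface_measure k. (dist x y)\<^sup>2 = (\<Sum>j\<in>UNIV - {k}. (x $ j - y $ j)\<^sup>2)"
    using AE_surface_measure[of k]
    by eventually_elim (simp add: dist_norm norm_sq_eq_sum sum.remove[of UNIV k] y)
  have M: "(\<integral>\<^sup>+x. ennreal (\<Prod>i\<in>UNIV - {k}. gauss1 s (x $ i - y $ i)) * ennreal ((dist x y)\<^sup>2) \<partial>surface_measure k)
      = ennreal (?N * (2 * s))" if s: "s > 0" for s
  proof -
    have "(\<integral>\<^sup>+x. ennreal (\<Prod>i\<in>UNIV - {k}. gauss1 s (x $ i - y $ i)) * ennreal ((dist x y)\<^sup>2) \<partial>surface_measure k)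
      = (\<integral>\<^sup>+x. ennreal ((\<Prod>i\<in>UNIV - {k}. gauss1 s (x $ i - y $ i)) * (\<Sum>j\<in>UNIV - {k}. (x $ j - y $ j)\<^sup>2)) \<partial>surface_measure k)"
    proof (rule nn_integral_cong_AE)
      show "AE x in surface_measure k. ennreal (\<Prod>i\<in>UNIV - {k}. gauss1 s (x $ i - y $ i)) * ennreal ((dist x y)\<^sup>2)
        = ennreal ((\<Prod>i\<in>UNIV - {k}. gauss1 s (x $ i - y $ i)) * (\<Sum>j\<in>UNIV - {k}. (x $ j - y $ j)\<^sup>2))"
        using d
      proof eventually_elim
        case (elim x)
        show ?case unfolding elim using s
          by (intro ennreal_mult[symmetric] prod_nonneg sum_nonneg) simp_all
      qed
    qed
    also have "\<dots> = ennreal (?N * (2 * s))"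
      unfolding surface_measure_eq_coord by (rule nn_integral_coord_gauss_moment[OF s])
    finally show ?thesis .
  qed
  have "(\<integral>\<^sup>+x. ennreal (H_kernel k x y t * (dist x y)\<^sup>2) \<partial>surface_measure k)
    = (\<integral>\<^sup>+x. ennreal (H_kernel k x y t) * ennreal ((dist x y)\<^sup>2) \<partial>surface_measure k)"
  proof (rule nn_integral_cong_AE)
    show "AE x in surface_measure k. ennreal (H_kernel k x y t * (dist x y)\<^sup>2) = ennreal (H_kernel k x y t) * ennreal ((dist x y)\<^sup>2)"
      using AE_surface_measure[of k]
      by eventually_elim (simp add: ennreal_mult H_kernel_nonneg y)
  qed
  also have "\<dots> = (\<integral>\<^sup>+\<tau>. ennreal ((y $ k + \<tau>) / (t - \<tau>) * gauss1 (t - \<tau>) (y $ k + \<tau>)) * ennreal (?N * (2 * (t - \<tau>))) * indicator {0<..<t} \<tau> \<partial>lborel)"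
    by (rule nn_integral_H_boundary_weighted[OF y' t _ M]) auto
  also have "\<dots> \<le> (\<integral>\<^sup>+\<tau>. ennreal (real CARD('n) * (2 * t)) *
      (ennreal ((y $ k + \<tau>) / (t - \<tau>) * gauss1 (t - \<tau>) (y $ k + \<tau>)) * indicator {0<..<t} \<tau>) \<partial>lborel)"
  proof (rule nn_integral_mono)
    fix \<tau>
    let ?X = "ennreal ((y $ k + \<tau>) / (t - \<tau>) * gauss1 (t - \<tau>) (y $ k + \<tau>))"
    have "?N * (2 * (t - \<tau>)) \<le> real CARD('n) * (2 * t)" if "\<tau> \<in> {0<..<t}"
      using that by (intro mult_mono) (auto intro!: card_mono)
    then have "?X * ennreal (?N * (2 * (t - \<tau>))) * indicator {0<..<t} \<tau> \<le> ?X * ennreal (real CARD('n) * (2 * t)) * indicator {0<..<t} \<tau>"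
      by (cases "\<tau> \<in> {0<..<t}") (simp_all add: mult_left_mono ennreal_leI del: ennreal_mult')
    then show "?X * ennreal (?N * (2 * (t - \<tau>))) * indicator {0<..<t} \<tau>
      \<le> ennreal (real CARD('n) * (2 * t)) * (?X * indicator {0<..<t} \<tau>)"
      by (simp only: mult_ac)
  qed
  also have "\<dots> = ennreal (real CARD('n) * (2 * t)) * (\<integral>\<^sup>+x. ennreal (H_kernel k x y t) \<partial>surface_measure k)"
    unfolding nn_integral_H_boundary[OF y' t] by (rule nn_integral_cmult) measurable
  also have "\<dots> \<le> ennreal (real CARD('n) * (2 * t)) * 1"
  proof (rule mult_left_mono)
    have "(\<integral>\<^sup>+x. ennreal (H_kernel k x y t) \<partial>surface_measure k) \<le> (\<integral>\<^sup>+x. ennreal (H_kernel k x y t) * indicator (half_space k) x \<partial>lborel)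
    + (\<integral>\<^sup>+x. ennreal (H_kernel k x y t) \<partial>surface_measure k)" by simp
    also have "\<dots> = 1" unfolding H_kernel_total_mass[OF y' t] by (simp add: y)
    finally show "(\<integral>\<^sup>+x. ennreal (H_kernel k x y t) \<partial>surface_measure k) \<le> 1" .
  qed simp
  finally show ?thesis by simp
qed

text \<open>Applied to \<open>y\<close> and to its reflection: the normal component changes sign and
  \<open>erf\<close> is odd, so the difference of the two masses is
  \<open>erf (y $ k / (2 * sqrt t))\<close>.\<close>

lemma nn_integral_gauss_half_space:
  fixes y :: "real ^ 'n::finite"
  assumes t: "t > 0"
  shows "(\<integral>\<^sup>+x. ennreal (gauss_kernel (x - y) t) * indicator (half_space k) x \<partial>lborel)
    = ennreal ((1 + erf (y $ k / (2 * sqrt t))) / 2)"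
proof -
  let ?\<psi> = "\<lambda>a. ennreal (gauss1 t (a + - (y $ k))) * indicator {0<..} a"
  have "ennreal (gauss_kernel (x - y) t) * indicator (half_space k) x
    = ?\<psi> (x $ k) * ennreal (\<Prod>i\<in>UNIV - {k}. gauss1 t (x $ i - y $ i))" for x
    using t by (simp add: gauss_kernel_split[OF t, of _ k] ennreal_mult prod_nonneg half_space_def indicator_def)
  then have "(\<integral>\<^sup>+x. ennreal (gauss_kernel (x - y) t) * indicator (half_space k) x \<partial>lborel)
    = (\<integral>\<^sup>+x. ?\<psi> (x $ k) * ennreal (\<Prod>i\<in>UNIV - {k}. gauss1 t (x $ i - y $ i)) \<partial>lborel)"
    by (simp only:)
  also have "\<dots> = (\<integral>\<^sup>+a. ?\<psi> a \<partial>lborel)"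
    by (rule nn_integral_lborel_split[OF t]) measurable
  also have "\<dots> = ennreal ((1 - erf (- (y $ k) / (2 * sqrt t))) / 2)"
    by (rule nn_integral_gauss1_tail[OF t])
  finally show ?thesis
    by (simp add: erf_minus)
qed

section \<open>Total mass and initial conditions\<close>

lemma integrable_mult_bounded:
  fixes g f :: "'a \<Rightarrow> real"
  assumes g: "integrable M g" and [measurable]: "f \<in> borel_measurable M" and B: "\<And>x. \<bar>f x\<bar> \<le> B"
  shows "integrable M (\<lambda>x. g x * f x)"
proof (rule Bochner_Integration.integrable_bound[OF integrable_mult_right[OF integrable_norm[OF g], of B]])
  show "(\<lambda>x. g x * f x) \<in> borel_measurable M" using g by measurable
  show "AE x in M. norm (g x * f x) \<le> norm (B * norm (g x))"
  proof (rule AE_I2)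
    fix x
    have "\<bar>g x\<bar> * \<bar>f x\<bar> \<le> \<bar>g x\<bar> * \<bar>B\<bar>"
      using B[of x] by (intro mult_left_mono) auto
    then show "norm (g x * f x) \<le> norm (B * norm (g x))"
      by (simp add: abs_mult mult.commute)
  qed
qed

lemma abs_integral_mult_bounded:
  fixes g f :: "'a \<Rightarrow> real"
  assumes g: "integrable M g" and f: "f \<in> borel_measurable M" and B: "\<And>x. \<bar>f x\<bar> \<le> B"
    and g0: "AE x in M. 0 \<le> g x"
  shows "\<bar>LINT x|M. g x * f x\<bar> \<le> B * (LINT x|M. g x)"
proof -
  have "\<bar>LINT x|M. g x * f x\<bar> \<le> (LINT x|M. \<bar>g x * f x\<bar>)"
    using integral_norm_bound[of M "\<lambda>x. g x * f x"] by simp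
  also have "\<dots> \<le> (LINT x|M. B * g x)"
  proof (rule integral_mono_AE)
    show "integrable M (\<lambda>x. \<bar>g x * f x\<bar>)"
      using integrable_mult_bounded[OF g f B] by (rule integrable_abs)
    show "integrable M (\<lambda>x. B * g x)" using g by (rule integrable_mult_right)
    show "AE x in M. \<bar>g x * f x\<bar> \<le> B * g x"
      using g0
    proof eventually_elim
      case (elim x)
      then have "g x * \<bar>f x\<bar> \<le> g x * B" using B[of x] by (intro mult_left_mono)
      with elim show ?case by (simp add: abs_mult mult.commute)
    qed
  qed
  also have "\<dots> = B * (LINT x|M. g x)" by simp
  finally show ?thesis .
qed

text \<open>
  Boundedness and continuity give \<open>|f x - f y| \<le> \<epsilon> + C |x - y|\<^sup>2\<close>, so a vanishing second moment replaces
  the usual estimate of the tails.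
\<close>

lemma approximate_identity:
  fixes p :: "real \<Rightarrow> 'a::{metric_space, second_countable_topology} \<Rightarrow> real"
  assumes M [measurable_cong]: "sets M = sets borel" and S: "AE x in M. x \<in> S"
    and p [measurable]: "\<And>t. p t \<in> borel_measurable M"
    and p0: "\<And>t. t > 0 \<Longrightarrow> AE x in M. 0 \<le> p t x"
    and mass: "\<And>t. t > 0 \<Longrightarrow> (\<integral>\<^sup>+x. ennreal (p t x) \<partial>M) = ennreal (m t)" "\<And>t. t > 0 \<Longrightarrow> 0 \<le> m t"
    and mom: "\<And>t. t > 0 \<Longrightarrow> (\<integral>\<^sup>+x. ennreal (p t x * (dist x y)\<^sup>2) \<partial>M) \<le> ennreal (v t)" "\<And>t. t > 0 \<Longrightarrow> 0 \<le> v t"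
    and m: "(m \<longlongrightarrow> 1) (at_right 0)" and v: "(v \<longlongrightarrow> 0) (at_right 0)"
    and f [measurable]: "f \<in> borel_measurable M" and B: "\<And>x. \<bar>f x\<bar> \<le> B"
    and y: "y \<in> S" and cont: "continuous (at y within S) f"
  shows "t > 0 \<Longrightarrow> integrable M (\<lambda>x. p t x * f x)"
    and "((\<lambda>t. LINT x|M. p t x * f x) \<longlongrightarrow> f y) (at_right 0)"
proof -
  have pi: "integrable M (p t)" "integral\<^sup>L M (p t) = m t" if "t > 0" for t
    using that mass[OF that] p0[OF that] by (auto intro: integrableI_nonneg simp: integral_eq_nn_integral)
  then show int: "integrable M (\<lambda>x. p t x * f x)" if "t > 0" for t
    using that f B by (intro integrable_mult_bounded) auto
  have vi: "integrable M (\<lambda>x. p t x * (dist x y)\<^sup>2)" "(LINT x|M. p t x * (dist x y)\<^sup>2) \<le> v t" if "t > 0" for t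
  proof -
    have n: "AE x in M. 0 \<le> p t x * (dist x y)\<^sup>2"
      using p0[OF that] by eventually_elim simp
    show i: "integrable M (\<lambda>x. p t x * (dist x y)\<^sup>2)"
      using n le_less_trans[OF mom(1)[OF that] ennreal_less_top] by (intro integrableI_nonneg) auto
    show "(LINT x|M. p t x * (dist x y)\<^sup>2) \<le> v t"
      using nn_integral_eq_integral[OF i n] mom[OF that] by simp
  qed
  have B0: "0 \<le> B" using B[of y] by linarith
  \<comment> \<open>The mass \<open>m t\<close> is close to 1 but need not equal it, so
    \<open>f y * m t\<close> is subtracted and its limit is restored at the end.\<close>
  have lim: "((\<lambda>t. (LINT x|M. p t x * f x) - f y * m t) \<longlongrightarrow> 0) (at_right 0)"
  proof (rule tendstoI)
    fix e :: real assume e: "e > 0"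
    \<comment> \<open>The final bound \<open>\<epsilon> * m t + C * v t\<close> tends to
      \<open>\<epsilon>\<close>; half of \<open>e\<close> leaves room for a strict
      inequality.\<close>
    define \<epsilon> where "\<epsilon> = e / 2"
    have \<epsilon>: "\<epsilon> > 0" using e by (simp add: \<epsilon>_def)
    from cont[unfolded continuous_within_eps_delta, rule_format, OF \<epsilon>]
    obtain \<delta> where \<delta>: "\<delta> > 0" "\<And>x. x \<in> S \<Longrightarrow> dist x y < \<delta> \<Longrightarrow> dist (f x) (f y) < \<epsilon>"
      by blast
    \<comment> \<open>At distance at least \<open>\<delta>\<close> from \<open>y\<close> one has
      \<open>|f x - f y| \<le> 2 * B \<le> 2 * B * (dist x y / \<delta>)^2\<close>, which is
      absorbed by the second moment.\<close>
    define C where "C = 2 * B / \<delta>\<^sup>2"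
    have C0: "0 \<le> C" using B0 by (simp add: C_def)
    have fb: "\<bar>f x - f y\<bar> \<le> \<epsilon> + C * (dist x y)\<^sup>2" if "x \<in> S" for x
    proof (cases "dist x y < \<delta>")
      case True
      have "0 \<le> C * (dist x y)\<^sup>2" using C0 by simp
      with \<delta>(2)[OF that True] show ?thesis by (simp add: dist_real_def)
    next
      case False
      then have "1 \<le> (dist x y / \<delta>)\<^sup>2"
        using \<delta>(1) by (intro one_le_power) simp
      then have "2 * B * 1 \<le> 2 * B * (dist x y / \<delta>)\<^sup>2"
        using B0 by (intro mult_left_mono) auto
      then have "2 * B \<le> C * (dist x y)\<^sup>2"
        by (simp add: C_def power_divide)
      moreover have "\<bar>f x - f y\<bar> \<le> 2 * B"
        using B[of x] B[of y] by linarith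
      ultimately show ?thesis using \<epsilon> by linarith
    qed
    have bound: "\<bar>(LINT x|M. p t x * f x) - f y * m t\<bar> \<le> \<epsilon> * m t + C * v t" if t: "t > 0" for t
    proof -
      have i1: "integrable M (\<lambda>x. p t x * f x - f y * p t x)"
        using int[OF t] pi(1)[OF t] by (intro Bochner_Integration.integrable_diff integrable_mult_right)
      have i2: "integrable M (\<lambda>x. \<epsilon> * p t x + C * (p t x * (dist x y)\<^sup>2))"
        using vi(1)[OF t] pi(1)[OF t] by (intro Bochner_Integration.integrable_add integrable_mult_right)
      have "(LINT x|M. p t x * f x) - f y * m t = (LINT x|M. p t x * f x - f y * p t x)"
        using int[OF t] pi[OF t] by simp
      also have "\<bar>\<dots>\<bar> \<le> (LINT x|M. \<bar>p t x * f x - f y * p t x\<bar>)"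
        using integral_norm_bound[of M "\<lambda>x. p t x * f x - f y * p t x"] by simp
      also have "\<dots> \<le> (LINT x|M. \<epsilon> * p t x + C * (p t x * (dist x y)\<^sup>2))"
      proof (rule integral_mono_AE[OF integrable_abs[OF i1] i2])
        show "AE x in M. \<bar>p t x * f x - f y * p t x\<bar> \<le> \<epsilon> * p t x + C * (p t x * (dist x y)\<^sup>2)"
          using p0[OF t] S
        proof eventually_elim
          case (elim x)
          have "\<bar>p t x * f x - f y * p t x\<bar> = p t x * \<bar>f x - f y\<bar>"
          proof -
            have "p t x * f x - f y * p t x = p t x * (f x - f y)" by (simp add: algebra_simps)
            then show ?thesis using elim(1) by (simp add: abs_mult)
          qed
          also have "\<dots> \<le> p t x * (\<epsilon> + C * (dist x y)\<^sup>2)"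
            using elim(1) fb[OF elim(2)] by (rule mult_left_mono[rotated])
          finally show ?case by (simp add: algebra_simps)
        qed
      qed
      also have "\<dots> = \<epsilon> * m t + C * (LINT x|M. p t x * (dist x y)\<^sup>2)"
        using vi(1)[OF t] pi[OF t] by simp
      also have "\<dots> \<le> \<epsilon> * m t + C * v t"
        using vi(2)[OF t] C0 by (intro add_left_mono mult_left_mono)
      finally show ?thesis .
    qed
    have "((\<lambda>t. \<epsilon> * m t + C * v t) \<longlongrightarrow> \<epsilon> * 1 + C * 0) (at_right 0)"
      by (intro tendsto_intros m v)
    then have "\<forall>\<^sub>F t in at_right 0. \<epsilon> * m t + C * v t < e"
      by (rule order_tendstoD(2)) (use e in \<open>simp add: \<epsilon>_def\<close>)
    moreover have "\<forall>\<^sub>F t in at_right 0. t > (0 :: real)"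
      by (simp add: eventually_at_filter)
    ultimately show "\<forall>\<^sub>F t in at_right 0. dist ((LINT x|M. p t x * f x) - f y * m t) 0 < e"
    proof eventually_elim
      case (elim t)
      with bound[OF elim(2)] show ?case by (simp add: dist_real_def)
    qed
  qed
  from tendsto_add[OF lim tendsto_mult[OF tendsto_const[of "f y"] m]]
  show "((\<lambda>t. LINT x|M. p t x * f x) \<longlongrightarrow> f y) (at_right 0)" by simp
qed

section \<open>Masses of \<open>H\<close> and \<open>G\<close> as real integrals\<close>

lemma erf_le_1: "erf w \<le> 1"
proof (rule tendsto_lowerbound[OF erf_tendsto_1])
  show "\<forall>\<^sub>F v in at_top. erf w \<le> erf v"
    using eventually_ge_at_top[of w]
  proof eventually_elim
    case (elim v)
    then show ?case
    proof (rule DERIV_nonneg_imp_nondecreasing)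
      fix x
      have "0 \<le> 2 / sqrt pi * exp (- x\<^sup>2)" by simp
      with DERIV_erf[of x] show "\<exists>d. (erf has_real_derivative d) (at x) \<and> 0 \<le> d" by blast
    qed
  qed
qed simp

lemma erf_ge_minus_1: "- 1 \<le> erf w"
  using erf_le_1[of "- w"] by (simp add: erf_minus)

text \<open>The known total is finite, hence so are both extended summands, and the equation passes
  to real numbers. The bound on \<open>a\<close> shows that the interior share disappears as
  \<open>t\<close> tends to 0.\<close>

lemma H_kernel_masses:
  fixes y :: "real ^ 'n::finite"
  assumes y: "0 \<le> y $ k" and t: "t > 0"
  obtains a b where "0 \<le> a" "0 \<le> b" "a \<le> 2 * sqrt t / sqrt pi" "a + b = 1 - erf (y $ k / (2 * sqrt t))"
    "(\<integral>\<^sup>+x. ennreal (H_kernel k x y t) * indicator (half_space k) x \<partial>lborel) = ennreal a"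
    "(\<integral>\<^sup>+x. ennreal (H_kernel k x y t) \<partial>surface_measure k) = ennreal b"
proof -
  let ?A = "\<integral>\<^sup>+x. ennreal (H_kernel k x y t) * indicator (half_space k) x \<partial>lborel"
  let ?B = "\<integral>\<^sup>+x. ennreal (H_kernel k x y t) \<partial>surface_measure k"
  have s: "?A + ?B = ennreal (1 - erf (y $ k / (2 * sqrt t)))"
    by (rule H_kernel_total_mass[OF assms])
  then have "?A + ?B < top" by (simp only: ennreal_less_top)
  then have fin: "?A < top" "?B < top" by (simp_all only: ennreal_add_less_top)
  define a b where "a = enn2real ?A" and "b = enn2real ?B"
  have ab: "0 \<le> a" "?A = ennreal a" "0 \<le> b" "?B = ennreal b"
    unfolding a_def b_def using fin by (simp_all only: enn2real_nonneg ennreal_enn2real)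
  have "ennreal (a + b) = ennreal (1 - erf (y $ k / (2 * sqrt t)))"
    unfolding ennreal_plus[OF ab(1,3)] s[symmetric] ab(2,4) by (rule refl)
  then have sum: "a + b = 1 - erf (y $ k / (2 * sqrt t))"
    by (rule ennreal_inj[THEN iffD1, rotated 2]) (use ab(1,3) erf_le_1 in simp_all)
  have "ennreal a \<le> ennreal (2 * sqrt t / sqrt pi)"
    unfolding ab(2)[symmetric] by (rule nn_integral_H_interior_le[OF assms])
  then have "a \<le> 2 * sqrt t / sqrt pi"
    by (rule ennreal_le_iff[THEN iffD1, rotated]) (use t in simp)
  from ab(1,3) this sum ab(2,4) show thesis by (rule that)
qed

lemma set_integral_of_nn_integral:
  fixes f :: "'a \<Rightarrow> real"
  assumes [measurable]: "f \<in> borel_measurable M" "S \<in> sets M"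
    and f: "\<And>x. x \<in> S \<Longrightarrow> 0 \<le> f x" and "0 \<le> c"
    and nn: "(\<integral>\<^sup>+x. ennreal (f x) * indicator S x \<partial>M) = ennreal c"
  shows "set_integrable M S f" "(LINT x:S|M. f x) = c"
proof -
  have *: "(\<integral>\<^sup>+x. ennreal (indicator S x *\<^sub>R f x) \<partial>M) = ennreal c"
    unfolding nn[symmetric] by (intro nn_integral_cong) (simp add: indicator_def)
  have 0: "AE x in M. 0 \<le> indicator S x *\<^sub>R f x"
    using f by (intro AE_I2) (simp add: indicator_def)
  show "set_integrable M S f"
    unfolding set_integrable_def using * 0 by (intro integrableI_nonneg) auto
  show "(LINT x:S|M. f x) = c"
    unfolding set_lebesgue_integral_def using * 0 \<open>0 \<le> c\<close> by (subst integral_eq_nn_integral) auto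
qed

lemma sets_surface_measure [simp]: "sets (surface_measure k) = sets borel"
  by (simp add: surface_measure_eq_coord)

lemma measurable_frontier_half_space [measurable]: "frontier (half_space k) \<in> sets borel"
  by (rule borel_closed) simp

lemma G_kernel_boundary: "x $ k = 0 \<Longrightarrow> G_kernel k x y t = H_kernel k x y t"
  using norm_diff_reflect[of x k y]
  by (simp add: G_kernel_def gauss_kernel_def)

lemma H_set_integral_interior:
  fixes y :: "real ^ 'n::finite"
  assumes y: "0 \<le> y $ k" and t: "t > 0"
    and "0 \<le> a" "(\<integral>\<^sup>+x. ennreal (H_kernel k x y t) * indicator (half_space k) x \<partial>lborel) = ennreal a"
  shows "set_integrable lborel (half_space k) (\<lambda>x. H_kernel k x y t)"
    "(LINT x:half_space k|lborel. H_kernel k x y t) = a"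
proof -
  have 1: "(\<lambda>x. H_kernel k x y t) \<in> borel_measurable lborel" "half_space k \<in> sets lborel"
    by measurable
  have 2: "0 \<le> H_kernel k x y t" if "x \<in> half_space k" for x
    using that y by (intro H_kernel_nonneg) (auto simp: half_space_def)
  note * = set_integral_of_nn_integral[where f = "\<lambda>x. H_kernel k x y t", OF 1 2 assms(3,4)]
  show "set_integrable lborel (half_space k) (\<lambda>x. H_kernel k x y t)"
    by (rule *(1))
  show "(LINT x:half_space k|lborel. H_kernel k x y t) = a"
    by (rule *(2))
qed

lemma G_kernel_mass:
  fixes y :: "real ^ 'n::finite"
  assumes y: "0 \<le> y $ k" and t: "t > 0"
  shows "set_integrable lborel (half_space k) (\<lambda>x. G_kernel k x y t)"
    and "set_integrable (surface_measure k) (frontier (half_space k)) (\<lambda>x. G_kernel k x y t)"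
    and "(LINT x:half_space k|lborel. G_kernel k x y t)
          + (LINT x:frontier (half_space k)|surface_measure k. G_kernel k x y t) = 1"
proof -
  obtain a b where ab: "0 \<le> a" "0 \<le> b" "a \<le> 2 * sqrt t / sqrt pi" "a + b = 1 - erf (y $ k / (2 * sqrt t))"
    "(\<integral>\<^sup>+x. ennreal (H_kernel k x y t) * indicator (half_space k) x \<partial>lborel) = ennreal a"
    "(\<integral>\<^sup>+x. ennreal (H_kernel k x y t) \<partial>surface_measure k) = ennreal b"
    by (rule H_kernel_masses[OF assms])
  note H = H_set_integral_interior[OF y t ab(1,5)]
  have g: "set_integrable lborel (half_space k) (\<lambda>x. gauss_kernel (x - z) t)"
    "(LINT x:half_space k|lborel. gauss_kernel (x - z) t) = (1 + erf (z $ k / (2 * sqrt t))) / 2" for z :: "real ^ 'n"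
  proof -
    have 1: "(\<lambda>x. gauss_kernel (x - z) t) \<in> borel_measurable lborel" "half_space k \<in> sets lborel"
      by measurable
    have 2: "0 \<le> (1 + erf (z $ k / (2 * sqrt t))) / 2"
      using erf_ge_minus_1[of "z $ k / (2 * sqrt t)"] by simp
    note * = set_integral_of_nn_integral[where f = "\<lambda>x. gauss_kernel (x - z) t", OF 1 gauss_kernel_nonneg 2
        nn_integral_gauss_half_space[OF t]]
    show "set_integrable lborel (half_space k) (\<lambda>x. gauss_kernel (x - z) t)"
      by (rule *(1))
    show "(LINT x:half_space k|lborel. gauss_kernel (x - z) t) = (1 + erf (z $ k / (2 * sqrt t))) / 2"
      by (rule *(2))
  qed
  show "set_integrable lborel (half_space k) (\<lambda>x. G_kernel k x y t)"
    unfolding G_kernel_def by (intro set_integral_add set_integral_diff g H)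
  have i: "(LINT x:half_space k|lborel. G_kernel k x y t) = erf (y $ k / (2 * sqrt t)) + a"
  proof -
    have "(LINT x:half_space k|lborel. G_kernel k x y t) = (LINT x:half_space k|lborel. gauss_kernel (x - y) t)
      - (LINT x:half_space k|lborel. gauss_kernel (x - reflect k y) t) + (LINT x:half_space k|lborel. H_kernel k x y t)"
      unfolding G_kernel_def
      by (subst set_integral_add(2)[OF set_integral_diff(1)[OF g(1) g(1)] H(1)],
          subst set_integral_diff(2)[OF g(1) g(1)]) (rule refl)
    also have "\<dots> = erf (y $ k / (2 * sqrt t)) + a"
      unfolding g(2) H(2) by (simp add: erf_minus field_simps)
    finally show ?thesis .
  qed
  have H0: "0 \<le> H_kernel k x y t" if "x \<in> frontier (half_space k)" for x
    using that y by (intro H_kernel_nonneg) (auto simp: frontier_half_space)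
  have nn: "(\<integral>\<^sup>+x. ennreal (H_kernel k x y t) * indicator (frontier (half_space k)) x \<partial>surface_measure k) = ennreal b"
    unfolding ab(6)[symmetric]
  proof (rule nn_integral_cong_AE)
    show "AE x in surface_measure k. ennreal (H_kernel k x y t) * indicator (frontier (half_space k)) x = ennreal (H_kernel k x y t)"
      using AE_surface_measure[of k] by eventually_elim (simp add: frontier_half_space)
  qed
  have 1: "(\<lambda>x. H_kernel k x y t) \<in> borel_measurable (surface_measure k)" "frontier (half_space k) \<in> sets (surface_measure k)"
    using measurable_H_kernel[of k y t] by (simp_all add: measurable_cong_sets[OF sets_surface_measure refl])
  note s = set_integral_of_nn_integral[where f = "\<lambda>x. H_kernel k x y t", OF 1 H0 ab(2) nn]
  have c: "indicator (frontier (half_space k)) x *\<^sub>R G_kernel k x y t = indicator (frontier (half_space k)) x *\<^sub>R H_kernel k x y t" for x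
    by (simp add: indicator_def frontier_half_space G_kernel_boundary)
  show "set_integrable (surface_measure k) (frontier (half_space k)) (\<lambda>x. G_kernel k x y t)"
    using s(1) unfolding set_integrable_def c .
  have "(LINT x:frontier (half_space k)|surface_measure k. G_kernel k x y t) = b"
    using s(2) unfolding set_lebesgue_integral_def c .
  then show "(LINT x:half_space k|lborel. G_kernel k x y t)
          + (LINT x:frontier (half_space k)|surface_measure k. G_kernel k x y t) = 1"
    using i ab(4) by simp
qed

section \<open>Initial conditions\<close>

lemma compactly_supported_bounded:
  assumes "compactly_supported_on S f"
  obtains B where "\<And>x. \<bar>indicator S x * f x\<bar> \<le> B"
proof -
  let ?K = "S \<inter> closure {x \<in> S. f x \<noteq> 0}"
  have "compact (f ` ?K)"
    using assms unfolding compactly_supported_on_def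
    by (intro compact_continuous_image) (auto intro: continuous_on_subset)
  then obtain B where B: "\<And>x. x \<in> ?K \<Longrightarrow> \<bar>f x\<bar> \<le> B"
    using compact_imp_bounded[of "f ` ?K"] by (auto simp: bounded_iff)
  have "\<bar>indicator S x * f x\<bar> \<le> max B 0" for x
  proof (cases "x \<in> S \<and> f x \<noteq> 0")
    case True
    then have "x \<in> ?K" using closure_subset[of "{x \<in> S. f x \<noteq> 0}"] by auto
    with B True show ?thesis by (simp add: le_max_iff_disj)
  next
    case False
    then have "indicator S x * f x = 0" by (cases "x \<in> S") simp_all
    then show ?thesis by (simp only: abs_zero max.cobounded2)
  qed
  then show thesis by (rule that)
qed

text \<open>Applied at the point \<open>y\<close> and at its reflection, which lies outside the
  half-space.\<close>

lemma gauss_approximate_identity: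
  fixes f :: "real ^ 'n::finite \<Rightarrow> real"
  assumes f: "f \<in> borel_measurable borel" and B: "\<And>x. \<bar>f x\<bar> \<le> B" and cont: "isCont f w"
  shows "t > 0 \<Longrightarrow> integrable lborel (\<lambda>x. gauss_kernel (x - w) t * f x)"
    and "((\<lambda>t. LINT x|lborel. gauss_kernel (x - w) t * f x) \<longlongrightarrow> f w) (at_right 0)"
proof -
  have mass: "(\<integral>\<^sup>+x. ennreal (gauss_kernel (x - w) t) \<partial>lborel) = ennreal 1" if "t > 0" for t
    using nn_integral_coord_gauss[OF that, of UNIV w]
    by (simp add: gauss_kernel_eq_prod[OF that] lborel_eq_coord)
  have mom: "(\<integral>\<^sup>+x. ennreal (gauss_kernel (x - w) t * (dist x w)\<^sup>2) \<partial>lborel) \<le> ennreal (real CARD('n) * (2 * t))" if "t > 0" for t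
    using nn_integral_coord_gauss_moment[OF that, of UNIV w]
    by (simp add: gauss_kernel_eq_prod[OF that] lborel_eq_coord dist_norm norm_sq_eq_sum)
  have v: "((\<lambda>t. real CARD('n) * (2 * t)) \<longlongrightarrow> 0) (at_right 0)"
    by (rule tendsto_eq_intros refl | simp)+
  have f': "f \<in> borel_measurable lborel" using f by simp
  have c: "continuous (at w within UNIV) f" using cont by simp
  have p: "(\<lambda>x. gauss_kernel (x - w) t) \<in> borel_measurable lborel" for t by measurable
  note * = approximate_identity[where M = lborel and S = UNIV and p = "\<lambda>t x. gauss_kernel (x - w) t" and m = "\<lambda>_. 1"
      and v = "\<lambda>t. real CARD('n) * (2 * t)" and f = f and B = B and y = w,
      OF sets_lborel _ p _ mass _ mom _ tendsto_const v f' B UNIV_I c]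
  show "t > 0 \<Longrightarrow> integrable lborel (\<lambda>x. gauss_kernel (x - w) t * f x)"
    by (rule *(1)) (simp_all add: gauss_kernel_nonneg)
  show "((\<lambda>t. LINT x|lborel. gauss_kernel (x - w) t * f x) \<longlongrightarrow> f w) (at_right 0)"
    by (rule *(2)) (simp_all add: gauss_kernel_nonneg)
qed

text \<open>With \<open>f\<close> the extension of \<open>\<zeta>\<close> by 0, the integral splits
  into three. The Gaussian at \<open>y\<close> gives \<open>\<zeta> y\<close>. The reflected one
  gives 0, because \<open>f\<close> vanishes near the reflection of \<open>y\<close>. The
  \<open>H\<close> part is at most the bound of \<open>f\<close> times the interior mass of
  \<open>H\<close>, hence of order \<open>sqrt t\<close>.\<close>

lemma G_kernel_initial_interior:
  fixes y :: "real ^ 'n::finite"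
  assumes \<zeta>: "compactly_supported_on (half_space k) \<zeta>" and y: "y \<in> half_space k"
  shows "t > 0 \<Longrightarrow> set_integrable lborel (half_space k) (\<lambda>x. G_kernel k x y t * \<zeta> x)"
    and "((\<lambda>t. LINT x:half_space k|lborel. G_kernel k x y t * \<zeta> x) \<longlongrightarrow> \<zeta> y) (at_right 0)"
proof -
  define f where "f = (\<lambda>x. indicator (half_space k) x * \<zeta> x)"
  obtain B where "\<And>x. \<bar>indicator (half_space k) x * \<zeta> x\<bar> \<le> B"
    using compactly_supported_bounded[OF \<zeta>] by blast
  then have B: "\<bar>f x\<bar> \<le> B" for x by (simp add: f_def)
  have cont: "continuous_on (half_space k) \<zeta>" using \<zeta> by (simp add: compactly_supported_on_def)
  have f [measurable]: "f \<in> borel_measurable borel"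
    using borel_measurable_continuous_on_indicator[OF measurable_half_space cont]
    by (simp add: f_def)
  have yk: "0 < y $ k" using y by (simp add: half_space_def)
  have "\<forall>\<^sub>F x in nhds y. x \<in> half_space k"
    using y by (intro eventually_nhds_in_open open_half_space)
  then have "\<forall>\<^sub>F x in nhds y. f x = \<zeta> x"
    by eventually_elim (simp add: f_def)
  then have c1: "isCont f y"
    using cont y by (simp add: isCont_cong continuous_on_eq_continuous_at[OF open_half_space])
  have "open {x :: real ^ 'n. x $ k < 0}" by (rule open_halfspace_component_lt_cart)
  then have "\<forall>\<^sub>F x in nhds (reflect k y). x \<in> {x. x $ k < 0}"
    using yk by (intro eventually_nhds_in_open) auto
  then have "\<forall>\<^sub>F x in nhds (reflect k y). f x = 0"
    by eventually_elim (simp add: f_def half_space_def)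
  then have c2: "isCont f (reflect k y)"
    by (simp add: isCont_cong)
  have fy: "f y = \<zeta> y" "f (reflect k y) = 0" using y yk by (simp_all add: f_def half_space_def)
  note g1 = gauss_approximate_identity[OF f B c1] and g2 = gauss_approximate_identity[OF f B c2]
  let ?h = "\<lambda>t x. indicator (half_space k) x *\<^sub>R H_kernel k x y t"
  have H: "integrable lborel (?h t)" "0 \<le> integral\<^sup>L lborel (?h t)" "integral\<^sup>L lborel (?h t) \<le> 2 * sqrt t / sqrt pi" if t: "t > 0" for t
  proof -
    obtain a b where a: "0 \<le> a" "0 \<le> b" "a \<le> 2 * sqrt t / sqrt pi" "a + b = 1 - erf (y $ k / (2 * sqrt t))"
      "(\<integral>\<^sup>+x. ennreal (H_kernel k x y t) * indicator (half_space k) x \<partial>lborel) = ennreal a"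
      "(\<integral>\<^sup>+x. ennreal (H_kernel k x y t) \<partial>surface_measure k) = ennreal b"
      by (rule H_kernel_masses[OF less_imp_le[OF yk] t])
    from H_set_integral_interior[OF less_imp_le[OF yk] t a(1,5)] a(1,3)
    show "integrable lborel (?h t)" "0 \<le> integral\<^sup>L lborel (?h t)" "integral\<^sup>L lborel (?h t) \<le> 2 * sqrt t / sqrt pi"
      by (simp_all add: set_integrable_def set_lebesgue_integral_def)
  qed
  have f': "f \<in> borel_measurable lborel" by simp
  have Hi: "integrable lborel (\<lambda>x. ?h t x * f x)" if "t > 0" for t
    by (rule integrable_mult_bounded[OF H(1)[OF that] f' B])
  have h0: "0 \<le> ?h t x" for t x
    using yk by (auto simp: indicator_def half_space_def intro!: H_kernel_nonneg)
  have Hb: "\<bar>LINT x|lborel. ?h t x * f x\<bar> \<le> B * (2 * sqrt t / sqrt pi)" if "t > 0" for t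
  proof -
    have "\<bar>LINT x|lborel. ?h t x * f x\<bar> \<le> B * (LINT x|lborel. ?h t x)"
      by (rule abs_integral_mult_bounded[OF H(1)[OF that] f' B AE_I2[OF h0]])
    also have "\<dots> \<le> B * (2 * sqrt t / sqrt pi)"
      using H(3)[OF that] B[of y] by (intro mult_left_mono) auto
    finally show ?thesis .
  qed
  have split: "indicator (half_space k) x *\<^sub>R (G_kernel k x y t * \<zeta> x)
    = gauss_kernel (x - y) t * f x - gauss_kernel (x - reflect k y) t * f x + ?h t x * f x" for t x
    by (simp add: f_def G_kernel_def indicator_def algebra_simps)
  show "set_integrable lborel (half_space k) (\<lambda>x. G_kernel k x y t * \<zeta> x)" if "t > 0" for t
    unfolding set_integrable_def split
    by (intro Bochner_Integration.integrable_add Bochner_Integration.integrable_diff g1(1) g2(1) Hi that)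
  have "((\<lambda>t. B * (2 * sqrt t / sqrt pi)) \<longlongrightarrow> B * (2 * sqrt 0 / sqrt pi)) (at_right 0)"
    by (intro tendsto_intros) auto
  then have b: "((\<lambda>t. B * (2 * sqrt t / sqrt pi)) \<longlongrightarrow> 0) (at_right 0)" by simp
  have pos: "\<forall>\<^sub>F t in at_right 0. t > (0 :: real)"
    by (simp add: eventually_at_filter)
  have "\<forall>\<^sub>F t in at_right 0. norm (LINT x|lborel. ?h t x * f x) \<le> B * (2 * sqrt t / sqrt pi)"
    using pos
  proof eventually_elim
    case (elim t)
    show ?case unfolding real_norm_def by (rule Hb[OF elim])
  qed
  then have "((\<lambda>t. LINT x|lborel. ?h t x * f x) \<longlongrightarrow> 0) (at_right 0)"
    using b by (rule Lim_null_comparison)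
  from tendsto_add[OF tendsto_diff[OF g1(2) g2(2)] this]
  have "((\<lambda>t. (LINT x|lborel. gauss_kernel (x - y) t * f x) - (LINT x|lborel. gauss_kernel (x - reflect k y) t * f x)
     + (LINT x|lborel. ?h t x * f x)) \<longlongrightarrow> \<zeta> y) (at_right 0)"
    by (simp add: fy)
  then show "((\<lambda>t. LINT x:half_space k|lborel. G_kernel k x y t * \<zeta> x) \<longlongrightarrow> \<zeta> y) (at_right 0)"
  proof (rule Lim_transform_eventually)
    show "\<forall>\<^sub>F t in at_right 0. (LINT x|lborel. gauss_kernel (x - y) t * f x) - (LINT x|lborel. gauss_kernel (x - reflect k y) t * f x)
       + (LINT x|lborel. ?h t x * f x) = (LINT x:half_space k|lborel. G_kernel k x y t * \<zeta> x)"
      using pos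
    proof eventually_elim
      case (elim t)
      show ?case
        unfolding set_lebesgue_integral_def split
        by (subst Bochner_Integration.integral_add[OF Bochner_Integration.integrable_diff[OF g1(1)[OF elim] g2(1)[OF elim]] Hi[OF elim]],
            subst Bochner_Integration.integral_diff[OF g1(1)[OF elim] g2(1)[OF elim]]) (rule refl)
    qed
  qed
qed

text \<open>On the boundary \<open>G = H\<close>, so \<open>H\<close> itself is the approximate
  identity. Since \<open>erf 0 = 0\<close>, its total mass is 1 and the interior takes at most
  \<open>2 * sqrt t / sqrt pi\<close> of it, which squeezes the boundary mass to 1.\<close>

lemma G_kernel_initial_boundary:
  fixes y :: "real ^ 'n::finite"
  assumes \<eta>: "compactly_supported_on (frontier (half_space k)) \<eta>" and y: "y \<in> frontier (half_space k)"
  shows "t > 0 \<Longrightarrow> set_integrable (surface_measure k) (frontier (half_space k)) (\<lambda>x. G_kernel k x y t * \<eta> x)"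
    and "((\<lambda>t. LINT x:frontier (half_space k)|surface_measure k. G_kernel k x y t * \<eta> x) \<longlongrightarrow> \<eta> y) (at_right 0)"
proof -
  let ?F = "frontier (half_space k)" and ?M = "surface_measure k"
  define f where "f = (\<lambda>x. indicator ?F x * \<eta> x)"
  obtain B where "\<And>x. \<bar>indicator ?F x * \<eta> x\<bar> \<le> B"
    using compactly_supported_bounded[OF \<eta>] by blast
  then have B: "\<bar>f x\<bar> \<le> B" for x by (simp add: f_def)
  have cont: "continuous_on ?F \<eta>" using \<eta> by (simp add: compactly_supported_on_def)
  have f: "f \<in> borel_measurable ?M"
    using borel_measurable_continuous_on_indicator[OF measurable_frontier_half_space cont]
    by (simp add: f_def measurable_cong_sets[OF sets_surface_measure refl])
  have y0: "y $ k = 0" using y by (simp add: frontier_half_space)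
  then have yk: "0 \<le> y $ k" by simp
  have "continuous_on ?F f"
    using cont by (rule continuous_on_eq) (simp add: f_def)
  then have c: "continuous (at y within ?F) f"
    using y by (simp add: continuous_on_eq_continuous_within)
  \<comment> \<open>The boundary mass is needed as a function of \<open>t\<close>; guarding the
    property by \<open>t > 0\<close> makes it solvable for every real \<open>t\<close>, so that
    choice applies.\<close>
  have "\<forall>t. \<exists>b. t > 0 \<longrightarrow> 0 \<le> b \<and> (\<integral>\<^sup>+x. ennreal (H_kernel k x y t) \<partial>?M) = ennreal b \<and> 1 - 2 * sqrt t / sqrt pi \<le> b \<and> b \<le> 1"
  proof
    fix t :: real
    show "\<exists>b. t > 0 \<longrightarrow> 0 \<le> b \<and> (\<integral>\<^sup>+x. ennreal (H_kernel k x y t) \<partial>?M) = ennreal b \<and> 1 - 2 * sqrt t / sqrt pi \<le> b \<and> b \<le> 1"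
    proof (cases "t > 0")
      case True
      obtain a b where ab: "0 \<le> a" "0 \<le> b" "a \<le> 2 * sqrt t / sqrt pi" "a + b = 1 - erf (y $ k / (2 * sqrt t))"
        "(\<integral>\<^sup>+x. ennreal (H_kernel k x y t) * indicator (half_space k) x \<partial>lborel) = ennreal a"
        "(\<integral>\<^sup>+x. ennreal (H_kernel k x y t) \<partial>surface_measure k) = ennreal b"
        by (rule H_kernel_masses[OF yk True])
      have "a + b = 1" using ab(4) unfolding y0 by simp
      then have "1 - 2 * sqrt t / sqrt pi \<le> b" "b \<le> 1" using ab(1,3) by linarith+
      with ab(2,6) show ?thesis by blast
    qed simp
  qed
  then have "\<exists>m. \<forall>t>0. 0 \<le> m t \<and> (\<integral>\<^sup>+x. ennreal (H_kernel k x y t) \<partial>?M) = ennreal (m t) \<and> 1 - 2 * sqrt t / sqrt pi \<le> m t \<and> m t \<le> 1"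
    by (rule choice)
  then obtain m where *: "\<forall>t>0. 0 \<le> m t \<and> (\<integral>\<^sup>+x. ennreal (H_kernel k x y t) \<partial>?M) = ennreal (m t) \<and> 1 - 2 * sqrt t / sqrt pi \<le> m t \<and> m t \<le> 1"
    by (rule exE)
  then have m: "0 \<le> m t" "(\<integral>\<^sup>+x. ennreal (H_kernel k x y t) \<partial>?M) = ennreal (m t)"
    "1 - 2 * sqrt t / sqrt pi \<le> m t" "m t \<le> 1" if "t > 0" for t
    using that by blast+
  have pos: "\<forall>\<^sub>F t in at_right 0. t > (0 :: real)"
    by (simp add: eventually_at_filter)
  have "((\<lambda>t. 1 - 2 * sqrt t / sqrt pi) \<longlongrightarrow> 1 - 2 * sqrt 0 / sqrt pi) (at_right 0)"
    by (intro tendsto_intros) auto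
  then have "((\<lambda>t. 1 - 2 * sqrt t / sqrt pi) \<longlongrightarrow> 1) (at_right 0)" by simp
  then have lim: "(m \<longlongrightarrow> 1) (at_right 0)"
    by (rule tendsto_sandwich[rotated 2, OF _ tendsto_const]) (use pos m(3,4) in \<open>auto elim!: eventually_mono\<close>)
  have v: "((\<lambda>t. real CARD('n) * (2 * t)) \<longlongrightarrow> 0) (at_right 0)"
    by (rule tendsto_eq_intros refl | simp)+
  have p: "(\<lambda>x. H_kernel k x y t) \<in> borel_measurable ?M" for t
    using measurable_H_kernel[of k y t] by (simp add: measurable_cong_sets[OF sets_surface_measure refl])
  have S: "AE x in ?M. x \<in> ?F"
    using AE_surface_measure[of k] by (simp add: frontier_half_space)
  have p0: "AE x in ?M. 0 \<le> H_kernel k x y t" for t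
    using AE_surface_measure[of k] by eventually_elim (simp add: H_kernel_nonneg yk)
  have v0: "0 \<le> real CARD('n) * (2 * t)" if "t > 0" for t using that by simp
  note * = approximate_identity[where M = ?M and S = ?F and p = "\<lambda>t x. H_kernel k x y t" and m = m
      and v = "\<lambda>t. real CARD('n) * (2 * t)" and f = f and B = B and y = y,
      OF sets_surface_measure S p p0 m(2) m(1) nn_integral_H_boundary_moment[OF y0] v0 lim v f B y c]
  have G: "indicator ?F x *\<^sub>R (G_kernel k x y t * \<eta> x) = H_kernel k x y t * f x" for x t
    by (simp add: f_def indicator_def frontier_half_space G_kernel_boundary)
  show "t > 0 \<Longrightarrow> set_integrable ?M ?F (\<lambda>x. G_kernel k x y t * \<eta> x)"
    unfolding set_integrable_def G by (rule *(1))
  have "f y = \<eta> y" using y by (simp add: f_def)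
  then show "((\<lambda>t. LINT x:?F|?M. G_kernel k x y t * \<eta> x) \<longlongrightarrow> \<eta> y) (at_right 0)"
    unfolding set_lebesgue_integral_def G using *(2) by simp
qed

theorem theorem1p1:
  fixes k :: "'n::finite"
  shows
    \<comment> \<open>the integral defining H converges\<close>
    "(\<forall>x \<in> closure (half_space k). \<forall>y \<in> closure (half_space k). \<forall>t > 0.
        set_integrable lborel {0<..<t} (H_integrand k x y t))
     \<and>
     \<comment> \<open>(1)(a)\<close>
     (\<forall>y \<in> closure (half_space k).
        (\<forall>x \<in> half_space k. \<forall>t > 0. \<exists>a L.
           ((\<lambda>s. G_kernel k x y s) has_real_derivative a) (at t) \<and>
           has_laplacian (\<lambda>z. G_kernel k z y t) L x \<and>
           a - L = 0) \<and>
        (\<forall>x \<in> frontier (half_space k). \<forall>t > 0. \<exists>a d.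
           ((\<lambda>s. G_kernel k x y s) has_real_derivative a) (at t) \<and>
           has_normal_deriv k (\<lambda>z. G_kernel k z y t) d x \<and>
           a + d = 0))
     \<and>
     \<comment> \<open>(1)(b)\<close>
     (\<forall>\<zeta>. compactly_supported_on (half_space k) \<zeta> \<longrightarrow>
        (\<forall>y \<in> half_space k.
           (\<forall>t > 0. set_integrable lborel (half_space k) (\<lambda>x. G_kernel k x y t * \<zeta> x)) \<and>
           ((\<lambda>t. LINT x:half_space k|lborel. G_kernel k x y t * \<zeta> x) \<longlongrightarrow> \<zeta> y) (at_right 0)))
     \<and>
     \<comment> \<open>(1)(c)\<close>
     (\<forall>\<eta>. compactly_supported_on (frontier (half_space k)) \<eta> \<longrightarrow>
        (\<forall>y \<in> frontier (half_space k).
           (\<forall>t > 0. set_integrable (surface_measure k) (frontier (half_space k))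
                      (\<lambda>x. G_kernel k x y t * \<eta> x)) \<and>
           ((\<lambda>t. LINT x:frontier (half_space k)|surface_measure k. G_kernel k x y t * \<eta> x)
              \<longlongrightarrow> \<eta> y) (at_right 0)))
     \<and>
     \<comment> \<open>(2)\<close>
     (\<forall>x \<in> closure (half_space k). \<forall>y \<in> closure (half_space k). \<forall>t > 0.
        G_kernel k x y t = G_kernel k y x t)
     \<and>
     \<comment> \<open>(3)\<close>
     (\<forall>y \<in> closure (half_space k). \<forall>t > 0.
        set_integrable lborel (half_space k) (\<lambda>x. G_kernel k x y t) \<and>
        set_integrable (surface_measure k) (frontier (half_space k)) (\<lambda>x. G_kernel k x y t) \<and>
        (LINT x:half_space k|lborel. G_kernel k x y t)
          + (LINT x:frontier (half_space k)|surface_measure k. G_kernel k x y t) = 1)"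
proof (intro conjI ballI allI impI)
  fix x y :: "real ^ 'n" and t :: real
  assume "x \<in> closure (half_space k)" "y \<in> closure (half_space k)" and t: "0 < t"
  then have xy: "0 \<le> x $ k" "0 \<le> y $ k" by (simp_all add: closure_half_space)
  then have "set_integrable lborel {0<..<t} (\<lambda>\<tau>. - (1 / 2) * dipole k (x - reflect k y + \<tau> *\<^sub>R axis k 1) (t - \<tau>))"
    using t by (intro set_integrable_mult_right set_integrable_dipole_ray) simp_all
  then show "set_integrable lborel {0<..<t} (H_integrand k x y t)"
    by (subst set_integrable_cong[OF refl refl H_integrand_eq]) simp_all
  show "G_kernel k x y t = G_kernel k y x t" by (rule G_kernel_commute)
next
  fix x y :: "real ^ 'n" and t :: real
  assume "y \<in> closure (half_space k)" "x \<in> half_space k" and t: "0 < t"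
  then have xy: "0 < x $ k" "0 \<le> y $ k" by (simp_all add: closure_half_space half_space_def)
  show "\<exists>a L. ((\<lambda>s. G_kernel k x y s) has_real_derivative a) (at t) \<and>
           has_laplacian (\<lambda>z. G_kernel k z y t) L x \<and> a - L = 0"
    by (intro exI conjI, rule G_kernel_DERIV_time[OF less_imp_le[OF xy(1)] xy(2) t], rule G_kernel_laplacian[OF xy t])
      (simp add: algebra_simps)
next
  fix x y :: "real ^ 'n" and t :: real
  assume "y \<in> closure (half_space k)" "x \<in> frontier (half_space k)" and t: "0 < t"
  then have xy: "x $ k = 0" "0 \<le> y $ k" by (simp_all add: closure_half_space frontier_half_space)
  then have x: "0 \<le> x $ k" by simp
  \<comment> \<open>Equal norms cancel the two Gauss terms in the time derivative; the remaining
    \<open>t * ray_source\<close> is the negative of the normal derivative.\<close>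
  have r: "norm (x - reflect k y) = norm (x - y)"
    using norm_diff_reflect[of x k y] xy(1) by simp
  show "\<exists>a d. ((\<lambda>s. G_kernel k x y s) has_real_derivative a) (at t) \<and>
           has_normal_deriv k (\<lambda>z. G_kernel k z y t) d x \<and> a + d = 0"
    by (intro exI conjI, rule G_kernel_DERIV_time[OF x xy(2) t], rule G_kernel_normal_deriv[OF xy t]) (simp add: r)
next
  fix \<zeta> :: "real ^ 'n \<Rightarrow> real" and y :: "real ^ 'n"
  assume *: "compactly_supported_on (half_space k) \<zeta>" "y \<in> half_space k"
  show "set_integrable lborel (half_space k) (\<lambda>x. G_kernel k x y t * \<zeta> x)" if "0 < t" for t
    by (rule G_kernel_initial_interior(1)[OF * that])
  show "((\<lambda>t. LINT x:half_space k|lborel. G_kernel k x y t * \<zeta> x) \<longlongrightarrow> \<zeta> y) (at_right 0)"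
    by (rule G_kernel_initial_interior(2)[OF *])
next
  fix \<eta> :: "real ^ 'n \<Rightarrow> real" and y :: "real ^ 'n"
  assume *: "compactly_supported_on (frontier (half_space k)) \<eta>" "y \<in> frontier (half_space k)"
  show "set_integrable (surface_measure k) (frontier (half_space k)) (\<lambda>x. G_kernel k x y t * \<eta> x)" if "0 < t" for t
    by (rule G_kernel_initial_boundary(1)[OF * that])
  show "((\<lambda>t. LINT x:frontier (half_space k)|surface_measure k. G_kernel k x y t * \<eta> x) \<longlongrightarrow> \<eta> y) (at_right 0)"
    by (rule G_kernel_initial_boundary(2)[OF *])
next
  fix y :: "real ^ 'n" and t :: real
  assume "y \<in> closure (half_space k)" and t: "0 < t"
  then have y: "0 \<le> y $ k" by (simp add: closure_half_space)
  show "set_integrable lborel (half_space k) (\<lambda>x. G_kernel k x y t)"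
    by (rule G_kernel_mass(1)[OF y t])
  show "set_integrable (surface_measure k) (frontier (half_space k)) (\<lambda>x. G_kernel k x y t)"
    by (rule G_kernel_mass(2)[OF y t])
  show "(LINT x:half_space k|lborel. G_kernel k x y t)
          + (LINT x:frontier (half_space k)|surface_measure k. G_kernel k x y t) = 1"
    by (rule G_kernel_mass(3)[OF y t])
qed

end
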